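(* (i) The maximal stability intervals for $\mathcal U_q$ are exactly the singletons $\{q\}$ with $q\in\overline{\mathcal U}$, and the intervals $(q_1,q_2]$ where $(q_1,q_2)$ is a connected component of $(1,M+1]\setminus\mathcal V$. (ii) The maximal stability intervals for $\mathcal V_q$ are exactly the singletons $\{q\}$ with $q\in\mathcal U$, the interval $(1,\tilde q)$, and the intervals $[q_1,q_2)$ where $(q_1,q_2)$ is a connected component of $(1,M+1]\setminus\mathcal V$ with $q_1\neq1$.
   Context: Fix a positive integer $M$ and $A=\{0,1,\dots,M\}$. A sequence in $A^{\mathbb N}$ is finite if it has a last nonzero digit, infinite otherwise; doubly infinite if both it and $(M-c_i)$ are infinite. For $q\in(1,M+1]$ an expansion of $x$ in base $q$ is $(c_i)\in A^{\mathbb N}$ with $\sum c_iq^{-i}=x$; $J_q=[0,M/(q-1)]$. The quasi-greedy expansion $a(x,q)$ is the lexicographically largest infinite expansion of $x$. $\mathcal U$ (resp. $\mathcal V$) is the set of $q>1$ such that $1$ has a unique expansion (resp. a unique doubly infinite expansion) in base $q$; $\overline{\mathcal U}$ is the closure of $\mathcal U$; $\tilde q=\min\mathcal V$ (explicitly $m+1$ if $M=2m$, $(m+\sqrt{m^2+4m})/2$ if $M=2m-1$). $\mathcal U_q$ is the set of $x\in J_q$ with a unique expansion; for $q<M+1$, $\mathcal V_q$ is the set of $x\in J_q$ with a unique doubly infinite expansion, $\mathcal V_{M+1}=[0,1]$. $\mathcal U_q'$ and $\mathcal V_q'$ are the sets of quasi-greedy expansions $a(x,q)$ of the elements $x$ of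 $\mathcal U_q$ and $\mathcal V_q$ respectively. An interval $I\subseteq(1,M+1]$ is a stability interval for $\mathcal U_q$ (resp. $\mathcal V_q$) if $\mathcal U_q'=\mathcal U_r'$ (resp. $\mathcal V_q'=\mathcal V_r'$) for all $q,r\in I$; it is maximal if no interval $J\subseteq(1,M+1]$ properly containing $I$ is a stability interval. *)

theory Defs
  imports "HOL-Analysis.Analysis" "HOL-Library.Fun_Lexorder"
begin

text \<open>
  Digit sequences over the alphabet \<open>{0, ..., M}\<close> are functions on \<^typ>\<open>nat\<close>; the digit that is
  conventionally written \<open>c\<^sub>i\<close> with \<open>i \<ge> 1\<close> is \<open>c (i - 1)\<close> here.
\<close>

definition digit_seqs :: "nat \<Rightarrow> (nat \<Rightarrow> nat) set" where
  "digit_seqs M = {c. \<forall>i. c i \<le> M}"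

text \<open>
  Since \<open>finite_seq\<close> asks for a last nonzero digit, the zero sequence is infinite.
\<close>

definition finite_seq :: "(nat \<Rightarrow> nat) \<Rightarrow> bool" where
  "finite_seq c \<longleftrightarrow> (\<exists>n. c n \<noteq> 0 \<and> (\<forall>i>n. c i = 0))"

abbreviation infinite_seq :: "(nat \<Rightarrow> nat) \<Rightarrow> bool" where
  "infinite_seq c \<equiv> \<not> finite_seq c"

definition doubly_infinite_seq :: "nat \<Rightarrow> (nat \<Rightarrow> nat) \<Rightarrow> bool" where
  "doubly_infinite_seq M c \<longleftrightarrow> infinite_seq c \<and> infinite_seq (\<lambda>i. M - c i)"

definition is_expansion :: "nat \<Rightarrow> real \<Rightarrow> real \<Rightarrow> (nat \<Rightarrow> nat) \<Rightarrow> bool" where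
  "is_expansion M q x c \<longleftrightarrow> c \<in> digit_seqs M \<and> (\<lambda>i. real (c i) / q ^ Suc i) sums x"

definition J :: "nat \<Rightarrow> real \<Rightarrow> real set" where
  "J M q = {0..real M / (q - 1)}"

text \<open>\<^const>\<open>less_fun\<close> is the strict lexicographic order.\<close>

definition is_quasi_greedy :: "nat \<Rightarrow> real \<Rightarrow> real \<Rightarrow> (nat \<Rightarrow> nat) \<Rightarrow> bool" where
  "is_quasi_greedy M q x c \<longleftrightarrow>
     is_expansion M q x c \<and> infinite_seq c \<and>
     (\<forall>d. is_expansion M q x d \<and> infinite_seq d \<longrightarrow> d = c \<or> less_fun d c)"

definition quasi_greedy :: "nat \<Rightarrow> real \<Rightarrow> real \<Rightarrow> (nat \<Rightarrow> nat)" where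
  "quasi_greedy M q x = (THE c. is_quasi_greedy M q x c)"

definition univoque_bases :: "nat \<Rightarrow> real set" where
  "univoque_bases M = {q. 1 < q \<and> (\<exists>!c. is_expansion M q 1 c)}"

definition bi_univoque_bases :: "nat \<Rightarrow> real set" where
  "bi_univoque_bases M =
     {q. 1 < q \<and> (\<exists>!c. is_expansion M q 1 c \<and> doubly_infinite_seq M c)}"

definition min_bi_univoque_base :: "nat \<Rightarrow> real" where
  "min_bi_univoque_base M = (LEAST q. q \<in> bi_univoque_bases M)"

definition univoque_set :: "nat \<Rightarrow> real \<Rightarrow> real set" where
  "univoque_set M q = {x \<in> J M q. \<exists>!c. is_expansion M q x c}"

definition bi_univoque_set :: "nat \<Rightarrow> real \<Rightarrow> real set" where
  "bi_univoque_set M q =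
     (if q = real M + 1 then {0..1}
      else {x \<in> J M q. \<exists>!c. is_expansion M q x c \<and> doubly_infinite_seq M c})"

definition univoque_seqs :: "nat \<Rightarrow> real \<Rightarrow> (nat \<Rightarrow> nat) set" where
  "univoque_seqs M q = quasi_greedy M q ` univoque_set M q"

definition bi_univoque_seqs :: "nat \<Rightarrow> real \<Rightarrow> (nat \<Rightarrow> nat) set" where
  "bi_univoque_seqs M q = quasi_greedy M q ` bi_univoque_set M q"

text \<open>
  Stability is defined for an arbitrary base-indexed family \<open>S\<close>, to be instantiated with
  \<^term>\<open>univoque_seqs M\<close> and \<^term>\<open>bi_univoque_seqs M\<close>. Singletons count as intervals.
\<close>

definition stability_interval :: "nat \<Rightarrow> (real \<Rightarrow> (nat \<Rightarrow> nat) set) \<Rightarrow> real set \<Rightarrow> bool" where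
  "stability_interval M S I \<longleftrightarrow>
     is_interval I \<and> I \<subseteq> {1<..real M + 1} \<and> (\<forall>q\<in>I. \<forall>r\<in>I. S q = S r)"

definition maximal_stability_interval ::
    "nat \<Rightarrow> (real \<Rightarrow> (nat \<Rightarrow> nat) set) \<Rightarrow> real set \<Rightarrow> bool" where
  "maximal_stability_interval M S I \<longleftrightarrow>
     stability_interval M S I \<and> \<not> (\<exists>K. I \<subset> K \<and> stability_interval M S K)"

end

theory Submission
  imports Defs
begin

text \<open>
  Let \<open>a(q)\<close> be the quasi-greedy expansion of 1 in base \<open>q\<close>. Both families of sequences are described
  by comparing all tails and reflected tails of a sequence with \<open>a(q)\<close>, strictly for \<open>univoque_seqs\<close>
  and weakly for \<open>bi_univoque_seqs\<close>, and \<open>a(q)\<close> increases with \<open>q\<close>. If a sequence enters the family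
  between the bases \<open>q\<close> and \<open>r\<close>, the lexicographic supremum of its tails and reflected tails is
  \<open>a(v)\<close> for some \<open>v \<in> bi_univoque_bases\<close> between \<open>q\<close> and \<open>r\<close>; conversely such a \<open>v\<close> makes
  \<open>0 a(v)\<close> enter the family. So the families can change only at the bases in the closed set
  \<open>bi_univoque_bases\<close>, and the maximal intervals are the classes determined by this set. They are
  singletons exactly at its limit points from the left (the closure of \<open>univoque_bases\<close>) and, apart
  from the largest base, from the right (\<open>univoque_bases\<close>). The approximating bases come from
  prefixes \<open>w\<close> of \<open>a(q)\<close> via the periodic sequence alternating \<open>w\<close> and its reflection.
\<close>

section \<open>Lexicographic order\<close>

text \<open>The two families behave differently at endpoints because \<open>0 a(v)\<close> is weakly
  admissible in base \<open>v\<close> itself but strictly admissible only in larger bases. For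
  \<open>q < r\<close> the decisive set of bases is therefore \<open>{q..<r}\<close> in the strict
  case and \<open>{q<..r}\<close> in the weak case. The strict case has an extra obstacle: every
  tail may lie below \<open>a(r)\<close> while the supremum equals \<open>a(r)\<close>. If
  \<open>r\<close> is isolated from the left, \<open>a(r)\<close> equals one of its own reflected
  tails, and then a tail close enough to \<open>a(r)\<close> has a reflected tail above it. The same
  periods govern limit points: for a base in \<open>bi_univoque_bases\<close> below the top, a
  reflected period is the only obstruction to approximation from the left, an ordinary period the
  only one from the right. The alternating sequence has a reflected period itself, so it never
  yields univoque bases; approximating by those requires raising its second block.\<close>

definition lex_le :: "(nat \<Rightarrow> nat) \<Rightarrow> (nat \<Rightarrow> nat) \<Rightarrow> bool" where
  "lex_le c d \<longleftrightarrow> c = d \<or> less_fun c d"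

definition agree :: "nat \<Rightarrow> (nat \<Rightarrow> nat) \<Rightarrow> (nat \<Rightarrow> nat) \<Rightarrow> bool" where
  "agree N c d \<longleftrightarrow> (\<forall>i<N. c i = d i)"

definition shift :: "nat \<Rightarrow> (nat \<Rightarrow> nat) \<Rightarrow> nat \<Rightarrow> nat" where
  "shift n c = (\<lambda>i. c (n + i))"

definition reflect :: "nat \<Rightarrow> (nat \<Rightarrow> nat) \<Rightarrow> nat \<Rightarrow> nat" where
  "reflect M c = (\<lambda>i. M - c i)"

lemma shift_0 [simp]: "shift 0 c = c"
  and shift_shift [simp]: "shift m (shift n c) = shift (n + m) c"
  and shift_apply [simp]: "shift n c i = c (n + i)"
  by (auto simp: shift_def add.assoc)

lemma reflect_apply [simp]: "reflect M c i = M - c i"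
  by (simp add: reflect_def)

lemma shift_reflect [simp]: "shift n (reflect M c) = reflect M (shift n c)"
  by (simp add: fun_eq_iff)

lemma digit_seqs_le: "c \<in> digit_seqs M \<Longrightarrow> c i \<le> M"
  by (simp add: digit_seqs_def)

lemma digit_seqs_shift [simp]: "c \<in> digit_seqs M \<Longrightarrow> shift n c \<in> digit_seqs M"
  and digit_seqs_reflect [simp]: "reflect M c \<in> digit_seqs M"
  by (auto simp: digit_seqs_def)

lemma reflect_reflect [simp]: "c \<in> digit_seqs M \<Longrightarrow> reflect M (reflect M c) = c"
  by (auto simp: digit_seqs_def fun_eq_iff)

lemma less_funI2: "c k < d k \<Longrightarrow> (\<And>i. i < k \<Longrightarrow> c i = d i) \<Longrightarrow> less_fun c d"
  for c d :: "nat \<Rightarrow> nat"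
  by (auto simp: less_fun_def)

lemma first_difference:
  fixes c d :: "nat \<Rightarrow> nat"
  assumes "c \<noteq> d"
  obtains k where "c k \<noteq> d k" "\<And>i. i < k \<Longrightarrow> c i = d i"
proof -
  obtain j where "c j \<noteq> d j" using assms by auto
  then have "c (LEAST k. c k \<noteq> d k) \<noteq> d (LEAST k. c k \<noteq> d k)" by (rule LeastI)
  moreover have "\<And>i. i < (LEAST k. c k \<noteq> d k) \<Longrightarrow> c i = d i" using not_less_Least by blast
  ultimately show ?thesis using that by blast
qed

lemma lex_cases: "less_fun c d \<or> c = d \<or> less_fun d c" for c d :: "nat \<Rightarrow> nat"
proof (cases "c = d")
  case False
  then obtain k where k: "c k \<noteq> d k" "\<And>i. i < k \<Longrightarrow> c i = d i" by (rule first_difference) blast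
  then show ?thesis using less_funI2[of c k d] less_funI2[of d k c] by (metis linorder_neqE_nat)
qed simp

lemma not_lex_le [simp]: "\<not> lex_le c d \<longleftrightarrow> less_fun d c"
  by (metis lex_le_def lex_cases less_fun_asym less_fun_irrefl)

lemma not_less_fun: "\<not> less_fun c d \<longleftrightarrow> lex_le d c" for c d :: "nat \<Rightarrow> nat"
  by (metis not_lex_le)

lemma lex_le_refl [simp]: "lex_le c c"
  by (simp add: lex_le_def)

lemma lex_le_trans [trans]: "lex_le a b \<Longrightarrow> lex_le b c \<Longrightarrow> lex_le a c"
  by (metis lex_le_def less_fun_trans)

lemma lex_le_less_trans [trans]: "lex_le a b \<Longrightarrow> less_fun b c \<Longrightarrow> less_fun a c"
  by (metis lex_le_def less_fun_trans)

lemma less_lex_le_trans [trans]: "less_fun a b \<Longrightarrow> lex_le b c \<Longrightarrow> less_fun a c"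
  by (metis lex_le_def less_fun_trans)

lemma lex_le_antisym: "lex_le a b \<Longrightarrow> lex_le b a \<Longrightarrow> a = b"
  by (metis lex_le_def less_fun_asym)

lemma less_fun_imp_lex_le: "less_fun a b \<Longrightarrow> lex_le a b"
  by (simp add: lex_le_def)

lemma less_fun_reflect:
  assumes "less_fun c d" "d \<in> digit_seqs M"
  shows "less_fun (reflect M d) (reflect M c)"
proof -
  obtain k where k: "c k < d k" "\<And>i. i < k \<Longrightarrow> c i = d i" using assms(1) by (auto elim: less_funE)
  then show ?thesis using digit_seqs_le[OF assms(2), of k] by (intro less_funI2[of _ k]) auto
qed

lemma lex_le_reflect: "lex_le c d \<Longrightarrow> d \<in> digit_seqs M \<Longrightarrow> lex_le (reflect M d) (reflect M c)"
  by (metis lex_le_def less_fun_reflect)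

section \<open>Comparison by finite prefixes\<close>

lemma agree_sym: "agree N c d \<Longrightarrow> agree N d c"
  by (simp add: agree_def)

lemma agree_mono: "agree N c d \<Longrightarrow> K \<le> N \<Longrightarrow> agree K c d"
  by (simp add: agree_def)

text \<open>A strict comparison is settled at the first difference, hence by finite prefixes. All
  limit arguments on sequences rest on this openness.\<close>

lemma less_fun_open:
  fixes c d :: "nat \<Rightarrow> nat"
  assumes "less_fun c d"
  obtains N where "\<And>c' d'. agree N c c' \<Longrightarrow> agree N d d' \<Longrightarrow> less_fun c' d'"
proof -
  obtain k where k: "c k < d k" "\<And>i. i < k \<Longrightarrow> c i = d i" using assms by (auto elim: less_funE)
  show ?thesis
    by (rule that[of "Suc k"], rule less_funI2[of _ k]) (use k in \<open>auto simp: agree_def\<close>)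
qed

lemma lex_le_head: "lex_le c d \<Longrightarrow> c 0 \<le> d 0"
  by (metis lex_le_def less_fun_def less_imp_le not_gr0 order_refl)

lemma lex_le_shift:
  assumes "lex_le c d" "\<And>i. i < n \<Longrightarrow> c i = d i"
  shows "lex_le (shift n c) (shift n d)"
proof (cases "c = d")
  case False
  then obtain k where k: "c k < d k" "\<And>i. i < k \<Longrightarrow> c i = d i"
    using assms(1) by (auto simp: lex_le_def elim: less_funE)
  have "n \<le> k" using k(1) assms(2)[of k] by (metis not_le less_irrefl)
  then have "less_fun (shift n c) (shift n d)"
    by (intro less_funI2[of _ "k - n"]) (use k in auto)
  then show ?thesis by (simp add: lex_le_def)
qed simp

text \<open>The lexicographic supremum is built digit by digit as the largest digit compatible with the
  prefix chosen so far.\<close>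

lemma lex_sup_exists:
  assumes "T \<noteq> {}" "T \<subseteq> digit_seqs M"
  obtains s where "s \<in> digit_seqs M" "\<And>t. t \<in> T \<Longrightarrow> lex_le t s" "\<And>N. \<exists>t\<in>T. agree N s t"
proof -
  define D where "D n p = {t n | t. t \<in> T \<and> agree n p t}" for n p
  \<comment> \<open>The state of the recursion is a whole function of which only the first
    \<open>n\<close> values are final; the others are still 0.\<close>
  define S where "S = rec_nat (\<lambda>_. 0 :: nat) (\<lambda>n p. p (n := Max (D n p)))"
  have S_Suc: "S (Suc n) = (S n) (n := Max (D n (S n)))" for n by (simp add: S_def)
  define s where "s n = S (Suc n) n" for n
  have S_s: "S n i = s i" if "i < n" for n i
    using that
  proof (induction n)
    case (Suc n)
    show ?case
    proof (cases "i = n")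
      case False
      then show ?thesis using Suc by (simp add: S_Suc)
    qed (simp add: s_def)
  qed simp
  have ag: "agree n (S n) t \<longleftrightarrow> agree n s t" for n t by (simp add: agree_def S_s)
  have D_eq: "D n (S n) = {t n | t. t \<in> T \<and> agree n s t}" for n by (simp add: D_def ag)
  have s_eq: "s n = Max (D n (S n))" for n by (simp add: s_def S_Suc)
  have fin: "finite (D n (S n))" for n
    by (rule finite_subset[of _ "{..M}"]) (use assms(2) in \<open>auto simp: D_def digit_seqs_def\<close>)
  have approx: "\<exists>t\<in>T. agree n s t" for n
  proof (induction n)
    case 0
    then show ?case using assms(1) by (auto simp: agree_def)
  next
    case (Suc n)
    then have "D n (S n) \<noteq> {}" by (auto simp: D_eq)
    then have "s n \<in> D n (S n)" using fin s_eq Max_in by metis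
    then obtain t where "t \<in> T" "agree n s t" "t n = s n" unfolding D_eq by auto
    then show ?case by (auto simp: agree_def less_Suc_eq)
  qed
  have "lex_le t s" if "t \<in> T" for t
  proof (rule ccontr)
    assume "\<not> lex_le t s"
    then obtain k where k: "s k < t k" "\<And>i. i < k \<Longrightarrow> s i = t i" by (auto elim: less_funE)
    then have "t k \<in> D k (S k)" using that by (auto simp: D_eq agree_def)
    then show False using k(1) fin s_eq by (metis Max_ge not_le)
  qed
  moreover have "s \<in> digit_seqs M"
    unfolding digit_seqs_def
  proof safe
    fix i
    obtain t where "t \<in> T" "agree (Suc i) s t" using approx by blast
    then show "s i \<le> M" using assms(2) by (auto simp: agree_def digit_seqs_def)
  qed
  ultimately show ?thesis using that approx by blast
qed

section \<open>Self-bounded sequences\<close>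

text \<open>When \<open>a\<close> is the quasi-greedy expansion of 1, \<open>weak_adm M a\<close> characterizes the elements of
  \<open>bi_univoque_seqs\<close> (below the largest base) and \<open>strict_adm M a\<close> those of \<open>univoque_seqs\<close>;
  \<open>bi_adm\<close> characterizes the quasi-greedy expansions of 1 in the bases of \<open>bi_univoque_bases\<close>.\<close>

definition weak_adm :: "nat \<Rightarrow> (nat \<Rightarrow> nat) \<Rightarrow> (nat \<Rightarrow> nat) \<Rightarrow> bool" where
  "weak_adm M a c \<longleftrightarrow> (\<forall>n. (c n < M \<longrightarrow> lex_le (shift (Suc n) c) a) \<and>
                          (0 < c n \<longrightarrow> lex_le (reflect M (shift (Suc n) c)) a))"

definition strict_adm :: "nat \<Rightarrow> (nat \<Rightarrow> nat) \<Rightarrow> (nat \<Rightarrow> nat) \<Rightarrow> bool" where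
  "strict_adm M a c \<longleftrightarrow> (\<forall>n. (c n < M \<longrightarrow> less_fun (shift (Suc n) c) a) \<and>
                            (0 < c n \<longrightarrow> less_fun (reflect M (shift (Suc n) c)) a))"

definition bi_adm :: "nat \<Rightarrow> (nat \<Rightarrow> nat) \<Rightarrow> bool" where
  "bi_adm M s \<longleftrightarrow> s \<in> digit_seqs M \<and>
     (\<forall>n. lex_le (shift n s) s \<and> lex_le (reflect M (shift n s)) s)"

lemma bi_adm_digits: "bi_adm M s \<Longrightarrow> s \<in> digit_seqs M"
  and bi_adm_shift_le: "bi_adm M s \<Longrightarrow> lex_le (shift n s) s"
  and bi_adm_reflect_le: "bi_adm M s \<Longrightarrow> lex_le (reflect M (shift n s)) s"
  unfolding bi_adm_def by blast+

lemma strict_adm_imp_weak_adm: "strict_adm M a c \<Longrightarrow> weak_adm M a c"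
  by (auto simp: strict_adm_def weak_adm_def lex_le_def)

lemma weak_adm_mono: "weak_adm M a c \<Longrightarrow> lex_le a b \<Longrightarrow> weak_adm M b c"
  unfolding weak_adm_def by (meson lex_le_trans)

lemma strict_adm_mono: "strict_adm M a c \<Longrightarrow> lex_le a b \<Longrightarrow> strict_adm M b c"
  unfolding strict_adm_def by (meson less_lex_le_trans)

text \<open>Deleting a leading \<open>M\<close> moves the first smaller digit, if there is one, one
  place forward.\<close>

lemma shift_Suc_0_le:
  assumes "s \<in> digit_seqs M" "s 0 = M"
  shows "lex_le (shift (Suc 0) s) s"
proof (cases "\<forall>i. s i = M")
  case True
  then have "shift (Suc 0) s = s" by auto
  then show ?thesis by simp
next
  case False
  define j where "j = (LEAST i. s i \<noteq> M)"
  have "s j \<noteq> M" "\<And>i. i < j \<Longrightarrow> s i = M"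
    using False LeastI_ex[of "\<lambda>i. s i \<noteq> M"] not_less_Least[of _ "\<lambda>i. s i \<noteq> M"]
    unfolding j_def by blast+
  moreover have "j \<noteq> 0" using \<open>s j \<noteq> M\<close> assms(2) by metis
  ultimately have "less_fun (shift (Suc 0) s) s"
    using digit_seqs_le[OF assms(1), of j] by (intro less_funI2[of _ "j - 1"]) auto
  then show ?thesis by (simp add: lex_le_def)
qed

text \<open>This is why admissibility can restrict its bounds to tails after a non-maximal digit:
  after \<open>M\<close> the bound is inherited from the preceding tail.\<close>

lemma lex_le_drop_head:
  assumes "s \<in> digit_seqs M" "lex_le x s" "x 0 = M"
  shows "lex_le (shift (Suc 0) x) s"
proof -
  have "s 0 = M" using lex_le_head[OF assms(2)] assms(3) digit_seqs_le[OF assms(1), of 0] by simp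
  then have "lex_le (shift (Suc 0) x) (shift (Suc 0) s)"
    using assms by (intro lex_le_shift) auto
  then show ?thesis using shift_Suc_0_le[OF assms(1) \<open>s 0 = M\<close>] lex_le_trans by blast
qed

text \<open>Cancelling the common first digit \<open>M\<close> of \<open>x\<close> and
  \<open>s\<close> gives \<open>lex_le s (shift (Suc 0) s)\<close>, while dropping the leading
  \<open>M\<close> of \<open>s\<close> gives the opposite inequality; so \<open>s\<close> is
  invariant under the shift. This excludes periods preceded by an extreme digit.\<close>

lemma cons_max_le_imp_const:
  assumes d: "s \<in> digit_seqs M" and x: "lex_le x s" "x 0 = M" "shift (Suc 0) x = s"
  shows "s = (\<lambda>_. M)"
proof -
  have s0: "s 0 = M" using lex_le_head[OF x(1)] x(2) digit_seqs_le[OF d, of 0] by simp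
  have "lex_le (shift (Suc 0) x) (shift (Suc 0) s)" using x(1,2) s0 by (intro lex_le_shift) auto
  then have "s = shift (Suc 0) s" using x(3) shift_Suc_0_le[OF d s0] lex_le_antisym by metis
  then have st: "s i = s (Suc i)" for i by (metis plus_1_eq_Suc shift_apply One_nat_def)
  have "s i = M" for i by (induction i) (use st s0 in auto)
  then show ?thesis by auto
qed

lemma self_bounded_shift:
  assumes "s \<in> digit_seqs M" "\<And>n. s n < M \<Longrightarrow> lex_le (shift (Suc n) s) s"
  shows "lex_le (shift n s) s"
proof (induction n)
  case (Suc n)
  show ?case
  proof (cases "s n < M")
    case False
    then have "shift n s 0 = M" using digit_seqs_le[OF assms(1), of n] by simp
    from lex_le_drop_head[OF assms(1) Suc this] show ?thesis by (simp del: shift_apply)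
  next
    case True
    then show ?thesis by (rule assms(2))
  qed
qed simp

text \<open>Positions after an extreme digit inherit their bound from the preceding position, and
  \<open>0 < s 0\<close> starts this induction for reflected tails. The unshifted reflection is not
  covered by \<open>weak_adm\<close>; there, comparing single digits with \<open>s 0\<close>
  suffices.\<close>

lemma bi_adm_iff_weak_adm:
  assumes "s \<in> digit_seqs M" "0 < s 0"
  shows "bi_adm M s \<longleftrightarrow> weak_adm M s s"
proof
  assume wa: "weak_adm M s s"
  have sh: "lex_le (shift n s) s" for n
    using self_bounded_shift[OF assms(1)] wa by (simp add: weak_adm_def)
  have rs: "lex_le (reflect M (shift (Suc n) s)) s" for n
  proof (induction n)
    case 0
    then show ?case using wa assms(2) by (simp add: weak_adm_def del: shift_apply reflect_apply)
  next
    case (Suc n)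
    show ?case
    proof (cases "0 < s (Suc n)")
      case False
      then have "reflect M (shift (Suc n) s) 0 = M" by simp
      from lex_le_drop_head[OF assms(1) Suc this] show ?thesis
        by (simp del: shift_apply reflect_apply)
    qed (use wa in \<open>simp add: weak_adm_def del: shift_apply reflect_apply\<close>)
  qed
  have "lex_le (reflect M s) s"
  proof (rule ccontr)
    assume "\<not> lex_le (reflect M s) s"
    then obtain i where i: "s i < M - s i" "\<And>j. j < i \<Longrightarrow> s j = M - s j"
      by (auto elim: less_funE)
    show False
    proof (cases i)
      case 0
      then show ?thesis using i(1) lex_le_head[OF sh[of 1]] lex_le_head[OF rs[of 0]] by auto
    next
      case (Suc j)
      then have "s 0 = M - s 0" using i(2)[of 0] by simp
      then show ?thesis using i(1) lex_le_head[OF rs[of j]] Suc by auto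
    qed
  qed
  then have "lex_le (reflect M (shift n s)) s" for n using rs[of "n - 1"] by (cases n) auto
  then show "bi_adm M s" using sh assms(1) by (simp add: bi_adm_def)
qed (use assms in \<open>auto simp: bi_adm_def weak_adm_def\<close>)

lemma bi_adm_head_pos:
  assumes "bi_adm M s" "M > 0"
  shows "0 < s 0"
proof -
  have "lex_le (shift 1 s) s" "lex_le (reflect M (shift 1 s)) s" using assms(1) by (auto simp: bi_adm_def)
  from this[THEN lex_le_head] show ?thesis using assms(2) by (simp; linarith)
qed

text \<open>Two zeros after the first digit would reflect to a tail starting with
  \<open>M M\<close>, which forces \<open>s 0 = M\<close> and then \<open>s 1 = M\<close>. The extra
  positive digit keeps the bases away from 1.\<close>

lemma bi_adm_second_digit:
  assumes "bi_adm M s" "M > 0"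
  shows "0 < s 1 \<or> 0 < s 2"
proof (rule ccontr)
  assume z: "\<not> ?thesis"
  define x where "x = reflect M (shift 1 s)"
  have le: "lex_le x s" using assms(1) by (simp add: bi_adm_def x_def)
  have x: "x 0 = M" "x 1 = M" using z by (auto simp: x_def numeral_2_eq_2)
  have "s 0 = M"
    using lex_le_head[OF le] x(1) assms(1) digit_seqs_le[of s M 0] by (simp add: bi_adm_def)
  then have "lex_le (shift 1 x) (shift 1 s)" using le x by (intro lex_le_shift) auto
  then show False using lex_le_head[of "shift 1 x" "shift 1 s"] x(2) z assms(2) by simp
qed

text \<open>A violated bound already shows in finite prefixes, so an approximating sequence would
  violate it too.\<close>

lemma bi_adm_closed:
  assumes "\<And>N. \<exists>t. bi_adm M t \<and> agree N s t"
  shows "bi_adm M s"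
  unfolding bi_adm_def
proof (intro conjI allI)
  show "s \<in> digit_seqs M"
    unfolding digit_seqs_def
  proof safe
    fix i
    obtain t where "bi_adm M t" "agree (Suc i) s t" using assms by blast
    then show "s i \<le> M" by (auto simp: agree_def bi_adm_def digit_seqs_def)
  qed
  \<comment> \<open>The map \<open>f\<close> stands for the shift or the reflected shift; it reads
    \<open>n\<close> digits ahead, which costs \<open>n\<close> digits of agreement.\<close>
  have gen: "lex_le (f s) s"
    if f: "\<And>N t. agree (n + N) s t \<Longrightarrow> agree N (f s) (f t)" and le: "\<And>t. bi_adm M t \<Longrightarrow> lex_le (f t) t"
    for f and n :: nat
  proof (rule ccontr)
    assume "\<not> lex_le (f s) s"
    then have "less_fun s (f s)" by simp
    then obtain N where N: "\<And>c' d'. agree N s c' \<Longrightarrow> agree N (f s) d' \<Longrightarrow> less_fun c' d'"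
      by (rule less_fun_open) blast
    obtain t where t: "bi_adm M t" "agree (n + N) s t" using assms by blast
    have "less_fun t (f t)" by (intro N f[OF t(2)] agree_mono[OF t(2)]) simp
    then show False using le[OF t(1)] by (metis not_lex_le)
  qed
  show "lex_le (shift n s) s" for n
    by (rule gen[of n "shift n"]) (simp_all add: bi_adm_def agree_def del: shift_apply, simp)
  show "lex_le (reflect M (shift n s)) s" for n
    by (rule gen[of n "\<lambda>s. reflect M (shift n s)"]) (auto simp: bi_adm_def agree_def)
qed

text \<open>Normalizing \<open>n\<close> to follow a nonzero digit makes the conditional inequality in \<open>strict_adm\<close>
  applicable.\<close>

lemma reflected_period_after_positive:
  assumes s: "bi_adm M s" "M > 0" and eq: "reflect M (shift n s) = s"
  obtains k where "0 < s k" "reflect M (shift (Suc k) s) = s"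
proof -
  have d: "s \<in> digit_seqs M" using s by (simp add: bi_adm_def)
  consider "n = 0" | k where "n = Suc k" "0 < s k" | k where "n = Suc k" "s k = 0"
    by (cases n) auto
  then show ?thesis
  proof cases
    case 1
    \<comment> \<open>Without a shift, \<open>s\<close> is fixed by the reflection, hence constant,
      and a shifted tail can replace \<open>s\<close>.\<close>
    then have h: "M - s i = s i" for i using eq by (auto simp: fun_eq_iff)
    have "s i = s 0" for i using h[of i] h[of 0] by linarith
    then have "s (Suc i) = s i" for i by metis
    then have "reflect M (shift (Suc 0) s) = s" using h by (auto simp: fun_eq_iff)
    then show ?thesis using that bi_adm_head_pos[OF s] by blast
  next
    case (2 k)
    then show ?thesis using that eq by blast
  next
    case (3 k)
    have "lex_le (reflect M (shift k s)) s" using s by (simp add: bi_adm_def)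
    moreover have "reflect M (shift k s) 0 = M" "shift (Suc 0) (reflect M (shift k s)) = s"
      using 3 eq by auto
    ultimately have "s = (\<lambda>_. M)" using cons_max_le_imp_const[OF d] by blast
    then show ?thesis using eq s(2) by (auto simp: fun_eq_iff)
  qed
qed

section \<open>Words and good prefixes\<close>

definition word_less :: "nat \<Rightarrow> (nat \<Rightarrow> nat) \<Rightarrow> (nat \<Rightarrow> nat) \<Rightarrow> bool" where
  "word_less n c d \<longleftrightarrow> (\<exists>i<n. c i < d i \<and> agree i c d)"

lemma word_lessI: "i < n \<Longrightarrow> c i < d i \<Longrightarrow> (\<And>j. j < i \<Longrightarrow> c j = d j) \<Longrightarrow> word_less n c d"
  by (auto simp: word_less_def agree_def)

lemma word_lessE:
  assumes "word_less n c d"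
  obtains i where "i < n" "c i < d i" "\<And>j. j < i \<Longrightarrow> c j = d j"
  using assms by (auto simp: word_less_def agree_def)

lemma word_less_mono: "word_less n c d \<Longrightarrow> n \<le> N \<Longrightarrow> word_less N c d"
  unfolding word_less_def by (meson less_le_trans)

lemma lex_le_word:
  assumes "lex_le c d"
  shows "agree n c d \<or> word_less n c d"
proof (cases "c = d")
  case False
  then obtain k where k: "c k < d k" "\<And>i. i < k \<Longrightarrow> c i = d i"
    using assms by (auto simp: lex_le_def elim: less_funE)
  then show ?thesis by (cases "k < n") (auto intro: word_lessI simp: agree_def)
qed (simp add: agree_def)

lemma word_less_trans:
  assumes "word_less n c d" "agree n d e \<or> word_less n d e"
  shows "word_less n c e"
proof -
  obtain i where i: "i < n" "c i < d i" "\<And>j. j < i \<Longrightarrow> c j = d j"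
    using assms(1) by (rule word_lessE) blast
  from assms(2) show ?thesis
  proof
    assume "agree n d e"
    then show ?thesis using i by (intro word_lessI[of i]) (auto simp: agree_def)
  next
    assume "word_less n d e"
    then obtain l where l: "l < n" "d l < e l" "\<And>j. j < l \<Longrightarrow> d j = e j"
      by (rule word_lessE) blast
    show ?thesis
      by (cases i l rule: linorder_cases)
        (use i l in \<open>auto intro: word_lessI[of i] word_lessI[of l]\<close>)
  qed
qed

lemma word_less_agree:
  assumes "word_less n c d" "agree n c c'" "agree n d d'"
  shows "word_less n c' d'"
proof -
  obtain i where i: "i < n" "c i < d i" "\<And>j. j < i \<Longrightarrow> c j = d j"
    using assms(1) by (rule word_lessE) blast
  show ?thesis by (rule word_lessI[of i]) (use i assms(2,3) in \<open>auto simp: agree_def\<close>)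
qed

lemma word_less_imp_less: "word_less n c d \<Longrightarrow> less_fun c d"
  by (auto elim!: word_lessE intro: less_funI2)

lemma agree_word_less_imp_less:
  assumes "agree n c d" "word_less l (shift n c) (shift n d)"
  shows "less_fun c d"
proof -
  obtain i where i: "c (n + i) < d (n + i)" "\<And>j. j < i \<Longrightarrow> c (n + j) = d (n + j)"
    using assms(2) by (auto elim!: word_lessE)
  show ?thesis
  proof (rule less_funI2[of _ "n + i"])
    fix j assume "j < n + i"
    then show "c j = d j"
      using assms(1) i(2)[of "j - n"] by (cases "j < n") (auto simp: agree_def)
  qed (use i in auto)
qed

text \<open>Only the first \<open>m\<close> digits of \<open>w\<close> are compared, so a sequence
  can serve as its own prefix. Strictness for reflected suffixes allows a following reflected block
  to break ties in the unreflected comparison.\<close>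

definition good_word :: "nat \<Rightarrow> nat \<Rightarrow> (nat \<Rightarrow> nat) \<Rightarrow> bool" where
  "good_word M m w \<longleftrightarrow> w \<in> digit_seqs M \<and>
     (\<forall>k<m. (agree (m - k) (shift k w) w \<or> word_less (m - k) (shift k w) w) \<and>
            word_less (m - k) (reflect M (shift k w)) w)"

text \<open>If a prefix of length \<open>m\<close> is good and \<open>shift m x\<close> first drops below \<open>s\<close> at position \<open>i\<close>, then
  the prefix ending there is good again, because the new tails are bounded by tails of \<open>s\<close>.\<close>

lemma prefix_word_less_step:
  assumes s: "\<And>l. lex_le (shift l s) s" and less: "less_fun (shift m x) s"
    and old: "\<And>k. k0 \<le> k \<Longrightarrow> k < m \<Longrightarrow> word_less (m - k) (shift k x) s"
  shows "\<exists>m'>m. (\<exists>i. x (m' - 1) < s i) \<and>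
           (\<forall>k. k0 \<le> k \<longrightarrow> k < m' \<longrightarrow> word_less (m' - k) (shift k x) s)"
proof -
  obtain i where i: "x (m + i) < s i" "\<And>j. j < i \<Longrightarrow> x (m + j) = s j"
    using less by (auto elim: less_funE)
  show ?thesis
  proof (rule exI[of _ "Suc (m + i)"], intro conjI allI impI)
    show "\<exists>i'. x (Suc (m + i) - 1) < s i'" using i(1) by auto
    fix k assume k: "k0 \<le> k" "k < Suc (m + i)"
    show "word_less (Suc (m + i) - k) (shift k x) s"
    proof (cases "k < m")
      case True
      show ?thesis by (rule word_less_mono[OF old[OF k(1) True]]) simp
    next
      case False
      define l where "l = k - m"
      have l: "k = m + l" "l \<le> i" using False k by (auto simp: l_def)
      have "word_less (Suc i - l) (shift k x) (shift l s)"
        using i l(2) by (intro word_lessI[of "i - l"]) (auto simp: l(1) add.assoc)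
      then show ?thesis using word_less_trans lex_le_word[OF s] l(1) by auto
    qed
  qed (use i in auto)
qed

text \<open>The cutoff \<open>k0\<close> is 1 when \<open>x\<close> is \<open>s\<close> itself,
  whose unshifted copy is not below \<open>s\<close>, and 0 for the reflection of \<open>s\<close>.
  The clause on \<open>x (m - 1)\<close> shows that the last digit of the prefix leaves room for an
  increase.\<close>

lemma prefixes_word_less:
  assumes s: "\<And>l. lex_le (shift l s) s" and less: "\<And>m. k0 \<le> m \<Longrightarrow> less_fun (shift m x) s"
  shows "\<exists>m>N. (\<exists>i. x (m - 1) < s i) \<and>
           (\<forall>k. k0 \<le> k \<longrightarrow> k < m \<longrightarrow> word_less (m - k) (shift k x) s)"
proof (induction N)
  case 0
  have "\<exists>m>k0. (\<exists>i. x (m - 1) < s i) \<and>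
      (\<forall>k. k0 \<le> k \<longrightarrow> k < m \<longrightarrow> word_less (m - k) (shift k x) s)"
    by (rule prefix_word_less_step[OF s less[OF order_refl]]) simp
  then show ?case using gr_zeroI by (metis not_less0)
next
  case (Suc N)
  then obtain m where m: "N < m" "\<forall>k. k0 \<le> k \<longrightarrow> k < m \<longrightarrow> word_less (m - k) (shift k x) s"
    by blast
  \<comment> \<open>If \<open>m\<close> is still below \<open>k0\<close>, the iteration restarts at
    \<open>k0\<close>, where nothing has to be inherited.\<close>
  define m1 where "m1 = max m k0"
  have "\<exists>m'>m1. (\<exists>i. x (m' - 1) < s i) \<and>
      (\<forall>k. k0 \<le> k \<longrightarrow> k < m' \<longrightarrow> word_less (m' - k) (shift k x) s)"
  proof (rule prefix_word_less_step[OF s less])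
    show "k0 \<le> m1" by (simp add: m1_def)
    show "word_less (m1 - k) (shift k x) s" if k: "k0 \<le> k" "k < m1" for k
    proof -
      have "k < m" "m1 = m" using k by (auto simp: m1_def)
      then show ?thesis using m(2) k(1) by blast
    qed
  qed
  moreover have "Suc N \<le> m1" using m(1) by (simp add: m1_def)
  ultimately show ?case by (meson le_less_trans)
qed

lemma good_prefixes:
  assumes s: "bi_adm M s" and ne: "\<And>n. reflect M (shift n s) \<noteq> s"
  obtains m where "N < m" "good_word M m s"
proof -
  have le: "lex_le (shift l s) s" for l using s by (simp add: bi_adm_def)
  have less: "less_fun (shift m (reflect M s)) s" if "0 \<le> m" for m
    using bi_adm_reflect_le[OF s, of m] ne[of m]
    by (simp add: lex_le_def del: shift_apply reflect_apply)
  have "\<exists>m>N. (\<exists>i. reflect M s (m - 1) < s i) \<and>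
      (\<forall>k. 0 \<le> k \<longrightarrow> k < m \<longrightarrow> word_less (m - k) (shift k (reflect M s)) s)"
    by (rule prefixes_word_less[OF le less])
  then obtain m where "N < m"
    and m: "\<And>k. k < m \<Longrightarrow> word_less (m - k) (reflect M (shift k s)) s"
    unfolding shift_reflect by blast
  have "good_word M m s"
    unfolding good_word_def
  proof (intro conjI allI impI)
    show "agree (m - k) (shift k s) s \<or> word_less (m - k) (shift k s) s" for k
      by (rule lex_le_word[OF le])
    show "word_less (m - k) (reflect M (shift k s)) s" if "k < m" for k
      by (rule m[OF that])
  qed (rule bi_adm_digits[OF s])
  with \<open>N < m\<close> show ?thesis by (rule that)
qed

text \<open>Raising the last digit turns the strict inequality of a suffix into at worst a tie, and
  it lowers the reflected suffixes, whose weak inequality becomes strict. Thus the absence of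
  ordinary periods yields good words just above \<open>s\<close>.\<close>

lemma good_increased_prefixes:
  assumes s: "bi_adm M s" and ne: "\<And>n. 0 < n \<Longrightarrow> shift n s \<noteq> s"
  obtains m where "N < m" "s m < M" "good_word M (Suc m) (s(m := Suc (s m)))"
proof -
  have d: "s \<in> digit_seqs M" using s by (simp add: bi_adm_def)
  have le: "lex_le (shift l s) s" for l using s by (simp add: bi_adm_def)
  have less: "less_fun (shift m s) s" if "1 \<le> m" for m
    using bi_adm_shift_le[OF s, of m] ne[of m] that by (simp add: lex_le_def del: shift_apply)
  have "\<exists>m'>Suc N. (\<exists>i. s (m' - 1) < s i) \<and>
      (\<forall>k. 1 \<le> k \<longrightarrow> k < m' \<longrightarrow> word_less (m' - k) (shift k s) s)"
    by (rule prefixes_word_less[OF le less])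
  then obtain m' i where m': "Suc N < m'" "s (m' - 1) < s i"
      "\<And>k. 1 \<le> k \<Longrightarrow> k < m' \<Longrightarrow> word_less (m' - k) (shift k s) s"
    by blast
  define m where "m = m' - 1"
  define w where "w = s(m := Suc (s m))"
  have m: "N < m" "m' = Suc m" using m'(1) by (auto simp: m_def)
  have sm: "s m < M" using m'(2) digit_seqs_le[OF d, of i] by (simp add: m_def)
  have "w \<in> digit_seqs M" using d sm by (auto simp: w_def digit_seqs_def)
  moreover have "agree (Suc m - k) (shift k w) w \<or> word_less (Suc m - k) (shift k w) w"
    if k: "k < Suc m" for k
  proof (cases "k = 0")
    case False
    then have "word_less (Suc m - k) (shift k s) s" using m'(3)[of k] k m(2) by simp
    then obtain i where "i < Suc m - k" and i: "s (k + i) < s i" "\<And>j. j < i \<Longrightarrow> s (k + j) = s j"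
      by (rule word_lessE) auto
    then have i: "k + i < Suc m" "s (k + i) < s i" "\<And>j. j < i \<Longrightarrow> s (k + j) = s j" by auto
    have eq: "w (k + j) = w j" if "j < i" for j using i that False by (auto simp: w_def)
    show ?thesis
    proof (cases "w (k + i) < w i")
      case True
      then show ?thesis using i(1) eq by (auto intro: word_lessI[of i])
    next
      case False
      then have "k + i = m" "w (k + i) = w i" using i k \<open>k \<noteq> 0\<close> by (auto simp: w_def split: if_splits)
      then show ?thesis using eq by (auto simp: agree_def less_Suc_eq)
    qed
  qed (simp add: agree_def)
  moreover have "word_less (Suc m - k) (reflect M (shift k w)) w" if k: "k < Suc m" for k
  proof -
    have "lex_le (reflect M (shift k s)) s" using s by (simp add: bi_adm_def)
    then consider "agree (Suc m - k) (reflect M (shift k s)) s"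
      | "word_less (Suc m - k) (reflect M (shift k s)) s" using lex_le_word by blast
    then show ?thesis
    proof cases
      case 1
      then have eq: "M - s (k + j) = s j" if "j < Suc m - k" for j using that by (simp add: agree_def)
      \<comment> \<open>In a tie the last digit decides: raising it lowers the reflected suffix, and
        for \<open>k = 0\<close> also raises the other side.\<close>
      have "M - s m = s (m - k)" using eq[of "m - k"] k by simp
      then have "M - Suc (s m) < s (m - k)" using sm by linarith
      then have "M - w m < w (m - k)" by (auto simp: w_def)
      moreover have "M - w (k + j) = w j" if "j < m - k" for j using eq[of j] that by (auto simp: w_def)
      ultimately show ?thesis using k by (intro word_lessI[of "m - k"]) auto
    next
      case 2
      then obtain i where "i < Suc m - k"
        and i: "M - s (k + i) < s i" "\<And>j. j < i \<Longrightarrow> M - s (k + j) = s j"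
        by (rule word_lessE) auto
      then have i: "k + i < Suc m" "M - s (k + i) < s i" "\<And>j. j < i \<Longrightarrow> M - s (k + j) = s j"
        by auto
      show ?thesis
        by (rule word_lessI[of i]) (use i k sm in \<open>auto simp: w_def\<close>)
    qed
  qed
  ultimately have "good_word M (Suc m) w" by (simp add: good_word_def)
  then show ?thesis using that m(1) sm by (simp add: w_def)
qed

text \<open>Write \<open>w'\<close> for the reflection of the word \<open>w\<close> of length \<open>m\<close>. Then \<open>zigzag M m w\<close> is
  \<open>w w' w w' ...\<close> and \<open>zigzag_succ M m w\<close> is \<open>w (w' + 1) w' w w' w ...\<close>, where \<open>+ 1\<close> increases
  the last digit.\<close>

definition zigzag :: "nat \<Rightarrow> nat \<Rightarrow> (nat \<Rightarrow> nat) \<Rightarrow> nat \<Rightarrow> nat" where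
  "zigzag M m w i = (if even (i div m) then w (i mod m) else M - w (i mod m))"

definition zigzag_succ :: "nat \<Rightarrow> nat \<Rightarrow> (nat \<Rightarrow> nat) \<Rightarrow> nat \<Rightarrow> nat" where
  "zigzag_succ M m w i =
     (if i < m then w i
      else if i < 2 * m then M - w (i - m) + (if i = 2 * m - 1 then 1 else 0)
      else zigzag M m w (i - m))"

section \<open>Comparison of tails across blocks\<close>

context
  fixes M m :: nat and w :: "nat \<Rightarrow> nat"
  assumes good: "good_word M m w" and m: "2 \<le> m"
begin

lemma word_le: "w i \<le> M"
  using good by (simp add: good_word_def digit_seqs_def)

lemma reflected_suffix_less: "j < m \<Longrightarrow> word_less (m - j) (reflect M (shift j w)) w"
  using good by (simp add: good_word_def)

text \<open>Reflecting \<open>reflected_suffix_less\<close> exchanges its two sides. The result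
  settles comparisons that are tied up to the end of a block.\<close>

lemma reflected_word_less_suffix:
  assumes "0 < j" "j < m"
  shows "word_less j (reflect M w) (shift (m - j) w)"
proof -
  have "word_less j (reflect M (shift (m - j) w)) w"
    using reflected_suffix_less[of "m - j"] assms by simp
  then obtain i where i: "i < j" "M - w (m - j + i) < w i" "\<And>l. l < i \<Longrightarrow> M - w (m - j + l) = w l"
    by (auto elim!: word_lessE)
  show ?thesis
  proof (rule word_lessI[OF i(1)])
    show "reflect M w i < shift (m - j) w i"
      using i(2) word_le[of i] word_le[of "m - j + i"] by simp
    show "reflect M w l = shift (m - j) w l" if "l < i" for l
      using i(3)[OF that] word_le[of l] word_le[of "m - j + l"] by simp
  qed
qed

lemma last_digit_pos: "0 < w (m - 1)"
proof -
  have "word_less 1 (reflect M (shift (m - 1) w)) w"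
    using reflected_suffix_less[of "m - 1"] m by simp
  then show ?thesis using word_le[of 0] word_le[of "m - 1"] by (auto elim!: word_lessE)
qed

lemma less_if_reflected_suffix:
  assumes "agree m y w" "j < m" "agree (m - j) z (reflect M (shift j w))"
  shows "less_fun z y"
  using word_less_agree[OF reflected_suffix_less[OF assms(2)]] assms(1,3) agree_sym agree_mono
    word_less_imp_less by (metis diff_le_self)

text \<open>After the tie \<open>z\<close> starts a reflected block, while \<open>y\<close> still
  has the last \<open>j\<close> digits of \<open>w\<close> to come, and these are larger.\<close>

lemma less_by_next_block:
  assumes "agree m y w" "0 < j" "j < m" "agree (m - j) z w" "agree j (shift (m - j) z) (reflect M w)"
  shows "less_fun z y"
proof (rule agree_word_less_imp_less)
  show "agree (m - j) z y" using assms(1,4) by (simp add: agree_def)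
  show "word_less j (shift (m - j) z) (shift (m - j) y)"
    by (rule word_less_agree[OF reflected_word_less_suffix])
      (use assms in \<open>auto simp: agree_def\<close>)
qed

lemma less_if_suffix:
  assumes "agree m y w" "0 < j" "j < m" "agree (m - j) z (shift j w)"
    "agree j (shift (m - j) z) (reflect M w)"
  shows "less_fun z y"
proof -
  have "agree (m - j) (shift j w) w \<or> word_less (m - j) (shift j w) w"
    using good assms(3) by (simp add: good_word_def)
  then show ?thesis
  proof
    assume "agree (m - j) (shift j w) w"
    then show ?thesis using less_by_next_block[OF assms(1-3)] assms(4,5) by (simp add: agree_def)
  next
    assume "word_less (m - j) (shift j w) w"
    then have "word_less (m - j) z y"
      by (rule word_less_agree) (use assms in \<open>auto simp: agree_def\<close>)
    then show ?thesis by (rule word_less_imp_less)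
  qed
qed

text \<open>Reflecting the raised second block of \<open>zigzag_succ\<close> gives \<open>w\<close>
  with its last digit lowered; this loss makes the weak inequality of suffixes strict.\<close>

lemma less_if_decreased_suffix:
  assumes "agree m y w" "j < m" "\<And>i. i < m - j \<Longrightarrow> z i = w (j + i) - (if j + i = m - 1 then 1 else 0)"
  shows "less_fun z y"
proof -
  have "word_less (m - j) z (shift j w)"
    by (rule word_lessI[of "m - 1 - j"]) (use assms m last_digit_pos in auto)
  moreover have "agree (m - j) (shift j w) w \<or> word_less (m - j) (shift j w) w"
    using good assms(2) by (simp add: good_word_def)
  ultimately have "word_less (m - j) z w" by (rule word_less_trans)
  then have "word_less (m - j) z y"
    by (rule word_less_agree) (use assms in \<open>auto simp: agree_def\<close>)
  then show ?thesis by (rule word_less_imp_less)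
qed

text \<open>Raising the last digit can spoil the strict inequality only if the first difference sits
  there and equals 1. For \<open>0 < j\<close> the next block breaks the tie; for
  \<open>j = 0\<close> a tie contradicts parity, where \<open>2 <= m\<close> separates the first
  digit from the last.\<close>

lemma less_if_increased_reflected_suffix:
  assumes "agree m y w" "j < m"
    "\<And>i. i < m - j \<Longrightarrow> z i = M - w (j + i) + (if j + i = m - 1 then 1 else 0)"
    "agree j (shift (m - j) z) (reflect M w)"
  shows "less_fun z y"
proof -
  obtain i where i0: "i < m - j" and i: "M - w (j + i) < w i" "\<And>l. l < i \<Longrightarrow> M - w (j + l) = w l"
    using reflected_suffix_less[OF assms(2)] by (auto elim!: word_lessE)
  then have i: "j + i < m" "M - w (j + i) < w i" "\<And>l. l < i \<Longrightarrow> M - w (j + l) = w l" by auto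
  have eq: "z l = y l" if "l < i" for l
    using that i assms(1) assms(3)[of l] by (auto simp: agree_def)
  have zi: "z i \<le> y i" using i(1,2) assms(1) assms(3)[of i] by (auto simp: agree_def)
  show ?thesis
  proof (cases "z i < y i")
    case True
    then show ?thesis using eq less_funI2 by blast
  next
    case False
    then have zy: "z i = y i" using zi by simp
    have last: "j + i = m - 1" using zy i(1,2) assms(1) assms(3)[of i] by (auto simp: agree_def split: if_splits)
    show ?thesis
    proof (cases "j = 0")
      case True
      text \<open>Here \<open>M = 2 * w 0\<close> and \<open>M + 1 = 2 * w (m - 1)\<close>, which contradicts parity.\<close>
      have "M - w 0 = w 0" using i(3)[of 0] last m True by simp
      moreover have "M - w (m - 1) + 1 = w (m - 1)"
        using zy last True assms(1) assms(3)[of i] m by (simp add: agree_def)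
      ultimately have "M = 2 * w 0" "M + 1 = 2 * w (m - 1)"
        using word_le[of 0] word_le[of "m - 1"] by linarith+
      then show ?thesis by presburger
    next
      case False
      have "agree (m - j) z w"
        unfolding agree_def
      proof safe
        fix l assume "l < m - j"
        then show "z l = w l"
          using eq[of l] zy last assms(1) by (cases "l = i") (auto simp: agree_def)
      qed
      then show ?thesis using less_by_next_block assms False by blast
    qed
  qed
qed

section \<open>The alternating sequence\<close>

lemma zigzag_lt: "i < m \<Longrightarrow> zigzag M m w i = w i"
  by (simp add: zigzag_def)

lemma zigzag_add [simp]: "zigzag M m w (m + i) = M - zigzag M m w i"
proof -
  have "(m + i) div m = Suc (i div m)" using m by simp
  then show ?thesis using word_le by (simp add: zigzag_def)
qed

lemma zigzag_le: "zigzag M m w i \<le> M"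
  using word_le by (simp add: zigzag_def)

lemma zigzag_digits: "zigzag M m w \<in> digit_seqs M"
  by (simp add: digit_seqs_def zigzag_le)

lemma shift_zigzag_add: "shift (m + k) (zigzag M m w) = reflect M (shift k (zigzag M m w))"
  by (simp add: fun_eq_iff add.assoc)

lemma shift_zigzag_cases:
  obtains j where "j < m" "shift k (zigzag M m w) = shift j (zigzag M m w)"
  | j where "j < m" "shift k (zigzag M m w) = reflect M (shift j (zigzag M m w))"
proof (induction k arbitrary: thesis rule: less_induct)
  case (less k)
  show ?case
  proof (cases "k < m")
    case False
    then have k: "shift k (zigzag M m w) = reflect M (shift (k - m) (zigzag M m w))" "k - m < k"
      using shift_zigzag_add[of "k - m"] m by auto
    from k(2) show ?thesis
    proof (rule less.IH)
      fix j assume "j < m" "shift (k - m) (zigzag M m w) = shift j (zigzag M m w)"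
      then show ?thesis using less.prems(2) k(1) by simp
    next
      fix j assume "j < m" "shift (k - m) (zigzag M m w) = reflect M (shift j (zigzag M m w))"
      then show ?thesis
        using less.prems(1) k(1) reflect_reflect[OF digit_seqs_shift[OF zigzag_digits, of j]]
        by simp
    qed
  qed (use less.prems in blast)
qed

lemma shift_zigzag_less:
  assumes "agree m y w" "0 < j" "j < m"
  shows "less_fun (shift j (zigzag M m w)) y"
proof (rule less_if_suffix[OF assms])
  show "agree (m - j) (shift j (zigzag M m w)) (shift j w)"
    by (auto simp: agree_def zigzag_lt)
  show "agree j (shift (m - j) (shift j (zigzag M m w))) (reflect M w)"
    using assms by (auto simp: agree_def zigzag_lt)
qed

lemma reflect_shift_zigzag_less:
  assumes "agree m y w" "j < m"
  shows "less_fun (reflect M (shift j (zigzag M m w))) y"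
  by (rule less_if_reflected_suffix[OF assms]) (auto simp: agree_def zigzag_lt)

lemma bi_adm_zigzag: "bi_adm M (zigzag M m w)"
proof -
  have ag: "agree m (zigzag M m w) w" by (simp add: agree_def zigzag_lt)
  have le: "lex_le (shift k (zigzag M m w)) (zigzag M m w)" for k
  proof (cases rule: shift_zigzag_cases[of k])
    case (1 j)
    then show ?thesis using shift_zigzag_less[OF ag, of j] by (cases "j = 0") (auto simp: lex_le_def)
  next
    case (2 j)
    then show ?thesis using reflect_shift_zigzag_less[OF ag, of j] by (auto simp: lex_le_def)
  qed
  \<comment> \<open>Reflecting a tail is the same as shifting it by \<open>m\<close>, so the bounds
    on reflected tails are among those already shown.\<close>
  then show ?thesis
    unfolding bi_adm_def using zigzag_digits shift_zigzag_add by metis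
qed

section \<open>The alternating sequence with raised second block\<close>

lemma zigzag_succ_digits: "zigzag_succ M m w \<in> digit_seqs M"
proof -
  have "M - w (m - 1) + 1 \<le> M" using last_digit_pos word_le[of "m - 1"] by simp
  moreover have "i - m = m - 1" if "i = 2 * m - 1" for i using that by simp
  ultimately show ?thesis using word_le zigzag_le by (auto simp: digit_seqs_def zigzag_succ_def)
qed

lemma agree_zigzag_succ: "agree m (zigzag_succ M m w) w"
  by (simp add: agree_def zigzag_succ_def)

lemma zigzag_less_succ: "less_fun (zigzag M m w) (zigzag_succ M m w)"
proof (rule less_funI2[of _ "2 * m - 1"])
  have v: "zigzag M m w i = M - w (i - m)" if "m \<le> i" "i < 2 * m" for i
    using zigzag_add[of "i - m"] zigzag_lt[of "i - m"] that by simp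
  show "zigzag M m w (2 * m - 1) < zigzag_succ M m w (2 * m - 1)"
    using v[of "2 * m - 1"] m by (auto simp: zigzag_succ_def)
  show "zigzag M m w i = zigzag_succ M m w i" if "i < 2 * m - 1" for i
    using v[of i] that by (auto simp: zigzag_succ_def zigzag_lt)
qed

lemma shift_zigzag_less_succ: "less_fun (shift k (zigzag M m w)) (zigzag_succ M m w)"
  using bi_adm_zigzag zigzag_less_succ by (auto simp: bi_adm_def intro: lex_le_less_trans)

lemma shift_zigzag_succ: "shift (2 * m + k) (zigzag_succ M m w) = shift (m + k) (zigzag M m w)"
  by (rule ext) (simp add: zigzag_succ_def mult_2 add.assoc)

text \<open>\<open>zigzag\<close> coincides with a reflected tail of itself, so its bounds cannot
  all be strict; raising the second block destroys this coincidence. Tails starting in the first two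
  blocks are compared block by block, and later ones are tails of \<open>zigzag\<close>, which lie
  below the raised sequence.\<close>

lemma zigzag_succ_strict:
  shows "0 < k \<Longrightarrow> less_fun (shift k (zigzag_succ M m w)) (zigzag_succ M m w)"
    and "less_fun (reflect M (shift k (zigzag_succ M m w))) (zigzag_succ M m w)"
proof -
  let ?t = "zigzag_succ M m w"
  note ag = agree_zigzag_succ
  consider "k < m" | j where "k = m + j" "j < m" | l where "k = 2 * m + l"
    by (metis add.assoc le_Suc_ex mult_2 not_less)
  note cases = this
  have mid: "?t (m + i) = M - w i + (if i = m - 1 then 1 else 0)" if "i < m" for i
    using that m by (auto simp: zigzag_succ_def)
  have late: "?t (2 * m + i) = M - w i" if "i < m" for i
    using that by (simp add: zigzag_succ_def mult_2 add.assoc zigzag_lt)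
  show "less_fun (shift k ?t) ?t" if "0 < k"
  proof (cases rule: cases)
    case 1
    show ?thesis
    proof (rule less_if_suffix[OF ag \<open>0 < k\<close> 1])
      show "agree (m - k) (shift k ?t) (shift k w)" by (auto simp: agree_def zigzag_succ_def)
      show "agree k (shift (m - k) (shift k ?t)) (reflect M w)"
        using 1 mid by (auto simp: agree_def)
    qed
  next
    case (2 j)
    show ?thesis
    proof (rule less_if_increased_reflected_suffix[OF ag 2(2)])
      show "shift k ?t i = M - w (j + i) + (if j + i = m - 1 then 1 else 0)" if "i < m - j" for i
        using mid[of "j + i"] that 2 by (simp add: add.assoc)
      show "agree j (shift (m - j) (shift k ?t)) (reflect M w)"
        using 2 late by (auto simp: agree_def mult_2)
    qed
  next
    case (3 l)
    then show ?thesis using shift_zigzag_less_succ by (simp add: shift_zigzag_succ del: shift_apply)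
  qed
  show "less_fun (reflect M (shift k ?t)) ?t"
  proof (cases rule: cases)
    case 1
    show ?thesis
      by (rule less_if_reflected_suffix[OF ag 1]) (auto simp: agree_def zigzag_succ_def)
  next
    case (2 j)
    show ?thesis
    proof (rule less_if_decreased_suffix[OF ag 2(2)])
      show "reflect M (shift k ?t) i = w (j + i) - (if j + i = m - 1 then 1 else 0)"
        if "i < m - j" for i
        using mid[of "j + i"] that 2 word_le[of "j + i"] by (simp add: add.assoc)
    qed
  next
    case (3 l)
    have "reflect M (shift k ?t) = shift l (zigzag M m w)"
      using digit_seqs_shift[OF zigzag_digits, of l]
      by (simp add: 3 shift_zigzag_succ shift_zigzag_add del: shift_apply)
    then show ?thesis using shift_zigzag_less_succ by simp
  qed
qed

end

declare shift_apply [simp del] reflect_apply [simp del]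

section \<open>Expansions\<close>

definition val :: "real \<Rightarrow> (nat \<Rightarrow> nat) \<Rightarrow> real" where
  "val q c = (\<Sum>i. real (c i) / q ^ Suc i)"

text \<open>The numerical form of quasi-greediness: a tail above 1 after a non-maximal digit would
  allow that digit to be raised.\<close>

definition small_tails :: "nat \<Rightarrow> real \<Rightarrow> (nat \<Rightarrow> nat) \<Rightarrow> bool" where
  "small_tails M q c \<longleftrightarrow> (\<forall>n. c n < M \<longrightarrow> val q (shift (Suc n) c) \<le> 1)"

lemma const_expansion_sums:
  assumes "1 < q"
  shows "(\<lambda>i. real M / q ^ Suc i) sums (real M / (q - 1))"
proof -
  have "(\<lambda>i. real M / q * (1 / q) ^ i) sums (real M / q * (1 / (1 - 1 / q)))"
    using assms by (intro sums_mult geometric_sums) auto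
  then show ?thesis using assms by (simp add: field_simps)
qed

lemma expansion_summable:
  assumes "c \<in> digit_seqs M" "1 < q"
  shows "summable (\<lambda>i. real (c i) / q ^ Suc i)"
proof (rule summable_comparison_test')
  show "summable (\<lambda>i. real M / q ^ Suc i)" using const_expansion_sums[OF assms(2)] sums_summable by blast
  show "norm (real (c i) / q ^ Suc i) \<le> real M / q ^ Suc i" if "i \<ge> 0" for i
    using assms digit_seqs_le[OF assms(1), of i] by (auto intro!: divide_right_mono)
qed

lemma is_expansion_iff:
  assumes "1 < q"
  shows "is_expansion M q x c \<longleftrightarrow> c \<in> digit_seqs M \<and> val q c = x"
  using expansion_summable[OF _ assms] by (auto simp: is_expansion_def val_def sums_iff)

lemma val_nonneg: "c \<in> digit_seqs M \<Longrightarrow> 1 < q \<Longrightarrow> 0 \<le> val q c"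
  unfolding val_def by (intro suminf_nonneg expansion_summable) auto

lemma val_pos:
  assumes "c \<in> digit_seqs M" "1 < q" "0 < c n"
  shows "0 < val q c"
  unfolding val_def using assms by (intro suminf_pos2[of _ n] expansion_summable) auto

lemma val_split:
  assumes "c \<in> digit_seqs M" "1 < q"
  shows "val q c = (\<Sum>i<n. real (c i) / q ^ Suc i) + val q (shift n c) / q ^ n"
proof -
  have "val q c = (\<Sum>i. real (c (i + n)) / q ^ Suc (i + n)) + (\<Sum>i<n. real (c i) / q ^ Suc i)"
    unfolding val_def using assms by (rule suminf_split_initial_segment[OF expansion_summable])
  also have "(\<Sum>i. real (c (i + n)) / q ^ Suc (i + n)) = (\<Sum>i. real (shift n c i) / q ^ Suc i / q ^ n)"
    by (simp add: power_add add.commute mult_ac shift_apply)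
  also have "\<dots> = val q (shift n c) / q ^ n"
    unfolding val_def using expansion_summable[OF digit_seqs_shift[OF assms(1)] assms(2), of n]
    by (rule suminf_divide)
  finally show ?thesis by simp
qed

lemma val_Suc:
  assumes "c \<in> digit_seqs M" "1 < q"
  shows "val q c = (real (c 0) + val q (shift (Suc 0) c)) / q"
  using val_split[OF assms, of "Suc 0"] by (simp add: add_divide_distrib)

lemma val_reflect:
  assumes "c \<in> digit_seqs M" "1 < q"
  shows "val q (reflect M c) = real M / (q - 1) - val q c"
proof -
  have "(\<lambda>i. real M / q ^ Suc i - real (c i) / q ^ Suc i) sums (real M / (q - 1) - val q c)"
    unfolding val_def
    by (intro sums_diff const_expansion_sums summable_sums expansion_summable[OF assms] assms(2))
  moreover have "real M / q ^ Suc i - real (c i) / q ^ Suc i = real (reflect M c i) / q ^ Suc i" for i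
    using digit_seqs_le[OF assms(1), of i] by (simp add: of_nat_diff diff_divide_distrib reflect_apply)
  ultimately show ?thesis unfolding val_def by (simp add: sums_iff)
qed

lemma val_le: "c \<in> digit_seqs M \<Longrightarrow> 1 < q \<Longrightarrow> val q c \<le> real M / (q - 1)"
  using val_nonneg[of "reflect M c" M q] val_reflect[of c M q] by simp

lemma val_const: "1 < q \<Longrightarrow> val q (\<lambda>_. M) = real M / (q - 1)"
  unfolding val_def using const_expansion_sums by (simp add: sums_iff)

lemma val_diff:
  assumes "c \<in> digit_seqs M" "d \<in> digit_seqs M" "1 < q" "\<And>j. j < i \<Longrightarrow> c j = d j"
  shows "val q d - val q c =
    (real (d i) - real (c i) + val q (shift (Suc i) d) - val q (shift (Suc i) c)) / q ^ Suc i"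
proof -
  have "(\<Sum>j<i. real (c j) / q ^ Suc j) = (\<Sum>j<i. real (d j) / q ^ Suc j)"
    by (rule sum.cong) (use assms(4) in auto)
  then show ?thesis
    using val_split[OF assms(1,3), of "Suc i"] val_split[OF assms(2,3), of "Suc i"]
    by (simp add: diff_divide_distrib add_divide_distrib del: power_Suc)
qed

lemma val_strict_antimono:
  assumes "c \<in> digit_seqs M" "1 < q" "q < r" "0 < c n"
  shows "val r c < val q c"
proof -
  have "0 < (\<Sum>i. real (c i) / q ^ Suc i - real (c i) / r ^ Suc i)"
  proof (rule suminf_pos2)
    show "summable (\<lambda>i. real (c i) / q ^ Suc i - real (c i) / r ^ Suc i)"
      using assms by (intro summable_diff expansion_summable) auto
    have *: "q ^ Suc i < r ^ Suc i" for i using assms by (intro power_strict_mono) auto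
    show "0 \<le> real (c i) / q ^ Suc i - real (c i) / r ^ Suc i" for i
      using assms *[of i] by (auto intro!: divide_left_mono simp del: power_Suc)
    show "0 < real (c n) / q ^ Suc n - real (c n) / r ^ Suc n"
      using assms *[of n] by (auto intro!: divide_strict_left_mono simp del: power_Suc)
  qed
  also have "\<dots> = val q c - val r c"
    unfolding val_def using assms by (intro suminf_diff[symmetric] expansion_summable) auto
  finally show ?thesis by simp
qed

lemma infinite_seqD: "infinite_seq c \<Longrightarrow> 0 < c n \<Longrightarrow> \<exists>j>n. 0 < c j"
  unfolding finite_seq_def by (metis neq0_conv)

lemma infinite_seq_shift: "infinite_seq c \<Longrightarrow> infinite_seq (shift n c)"
proof
  assume c: "infinite_seq c" and "finite_seq (shift n c)"
  then obtain k where k: "0 < c (n + k)" "\<And>i. k < i \<Longrightarrow> c (n + i) = 0"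
    by (auto simp: finite_seq_def shift_apply)
  then obtain j where j: "n + k < j" "0 < c j" using infinite_seqD[OF c] by blast
  then have "c (n + (j - n)) = 0" by (intro k(2)) auto
  then show False using j by simp
qed

lemma infinite_seq_tail_pos:
  assumes "c \<in> digit_seqs M" "1 < q" "infinite_seq c" "0 < c n"
  shows "0 < val q (shift (Suc n) c)"
proof -
  obtain j where "j > n" "0 < c j" using infinite_seqD[OF assms(3,4)] by blast
  then have "0 < shift (Suc n) c (j - Suc n)" by (simp add: shift_apply)
  then show ?thesis using val_pos[OF digit_seqs_shift[OF assms(1)] assms(2)] by blast
qed

text \<open>The first difference contributes at least 1 in favour of \<open>d\<close>, which pays
  for the tail of \<open>c\<close>; the positive tail of the infinite sequence \<open>d\<close>
  makes the inequality strict.\<close>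

lemma small_tails_less:
  assumes c: "c \<in> digit_seqs M" "small_tails M q c" and d: "d \<in> digit_seqs M" "infinite_seq d"
    and q: "1 < q" and less: "less_fun c d"
  shows "val q c < val q d"
proof -
  obtain i where i: "c i < d i" "\<And>j. j < i \<Longrightarrow> c j = d j" using less by (auto elim: less_funE)
  have "c i < M" using i(1) digit_seqs_le[OF d(1), of i] by simp
  then have "val q (shift (Suc i) c) \<le> 1" using c(2) by (simp add: small_tails_def)
  moreover have "0 < val q (shift (Suc i) d)" using infinite_seq_tail_pos[OF d(1) q d(2)] i(1) by auto
  moreover have "1 \<le> real (d i) - real (c i)" using i(1) by linarith
  ultimately have "0 < (real (d i) - real (c i) + val q (shift (Suc i) d) - val q (shift (Suc i) c)) / q ^ Suc i"
    using q by (intro divide_pos_pos) auto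
  then show ?thesis using val_diff[OF c(1) d(1) q, of i] i(2) by simp
qed

section \<open>Lexicographic bounds and values\<close>

context
  fixes M :: nat and a :: "nat \<Rightarrow> nat" and q :: real
  assumes q: "1 < q" and a: "a \<in> digit_seqs M" "val q a = 1"
begin

lemma lex_bounded_gap:
  assumes c: "c \<in> digit_seqs M" and i: "c i < a i" "\<And>j. j < i \<Longrightarrow> c j = a j"
  shows "val q c - 1 \<le> (val q (shift (Suc i) c) - 1 - val q (shift (Suc i) a)) / q ^ Suc i"
proof -
  have "1 - val q c = (real (a i) - real (c i) + val q (shift (Suc i) a) - val q (shift (Suc i) c)) / q ^ Suc i"
    using val_diff[OF c a(1) q, of i] i(2) a(2) by simp
  also have "\<dots> \<ge> (1 + val q (shift (Suc i) a) - val q (shift (Suc i) c)) / q ^ Suc i"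
    using i(1) q by (intro divide_right_mono) auto
  finally show ?thesis by (simp add: diff_divide_distrib add_divide_distrib)
qed

text \<open>By \<open>lex_bounded_gap\<close> an excess over 1 is passed on to a tail and divided by
  at least \<open>q\<close>. Iterating this from the trivial bound \<open>K\<close> leaves no
  excess.\<close>

lemma lex_bounded_val_le:
  assumes "c \<in> digit_seqs M" "lex_le c a" "\<And>n. c n < M \<Longrightarrow> lex_le (shift (Suc n) c) a"
  shows "val q c \<le> 1"
proof -
  define K where "K = real M / (q - 1)"
  have K: "0 \<le> K" using q by (simp add: K_def)
  have "val q c - 1 \<le> K / q ^ n"
    if "c \<in> digit_seqs M" "lex_le c a" "\<And>n. c n < M \<Longrightarrow> lex_le (shift (Suc n) c) a" for c n
    using that
  proof (induction n arbitrary: c)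
    case 0
    then show ?case using val_le[OF 0(1) q] by (simp add: K_def)
  next
    case (Suc n)
    show ?case
    proof (cases "c = a")
      case True
      then show ?thesis using a K q by simp
    next
      case False
      then obtain i where i: "c i < a i" "\<And>j. j < i \<Longrightarrow> c j = a j"
        using Suc.prems(2) by (auto simp: lex_le_def elim: less_funE)
      then have "c i < M" using digit_seqs_le[OF a(1), of i] by simp
      have "val q (shift (Suc i) c) - 1 \<le> K / q ^ n"
      proof (rule Suc.IH)
        show "lex_le (shift (Suc i) c) a" using Suc.prems(3) \<open>c i < M\<close> by blast
        show "lex_le (shift (Suc m) (shift (Suc i) c)) a" if "shift (Suc i) c m < M" for m
        proof -
          have "c (Suc i + m) < M" using that by (simp add: shift_apply)
          from Suc.prems(3)[OF this] show ?thesis by simp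
        qed
      qed (use Suc.prems(1) in simp)
      then have "val q (shift (Suc i) c) - 1 - val q (shift (Suc i) a) \<le> K / q ^ n"
        using val_nonneg[OF digit_seqs_shift[OF a(1)] q, of "Suc i"] by linarith
      then have "val q c - 1 \<le> (K / q ^ n) / q ^ Suc i"
        using lex_bounded_gap[OF Suc.prems(1) i] q
        by (smt (verit) divide_right_mono zero_le_power)
      \<comment> \<open>The first difference may be at position 0, so only one factor
        \<open>q\<close> is guaranteed.\<close>
      also have "\<dots> \<le> (K / q ^ n) / q"
        using q K self_le_power[of q "Suc i"] by (intro divide_left_mono) auto
      finally show ?thesis by (simp add: mult.commute)
    qed
  qed
  from this[OF assms] have "val q c - 1 \<le> K / q ^ n" for n .
  moreover have "(\<lambda>n. K / q ^ n) \<longlonglongrightarrow> 0"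
    using q by (intro LIMSEQ_divide_realpow_zero) auto
  ultimately have "val q c - 1 \<le> 0" by (intro LIMSEQ_le_const) auto
  then show ?thesis by simp
qed

lemma lex_bounded_val_less:
  assumes "c \<in> digit_seqs M" "less_fun c a" "\<And>n. c n < M \<Longrightarrow> lex_le (shift (Suc n) c) a" "infinite_seq a"
  shows "val q c < 1"
proof -
  obtain i where i: "c i < a i" "\<And>j. j < i \<Longrightarrow> c j = a j"
    using assms(2) by (auto elim: less_funE)
  then have "c i < M" using digit_seqs_le[OF a(1), of i] by simp
  have "val q (shift (Suc i) c) \<le> 1"
  proof (rule lex_bounded_val_le)
    show "lex_le (shift (Suc i) c) a" using assms(3) \<open>c i < M\<close> by blast
    show "lex_le (shift (Suc m) (shift (Suc i) c)) a" if "shift (Suc i) c m < M" for m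
    proof -
      have "c (Suc i + m) < M" using that by (simp add: shift_apply)
      from assms(3)[OF this] show ?thesis by simp
    qed
  qed (use assms(1) in simp)
  moreover have "0 < val q (shift (Suc i) a)" using infinite_seq_tail_pos[OF a(1) q assms(4)] i(1) by auto
  ultimately have "(val q (shift (Suc i) c) - 1 - val q (shift (Suc i) a)) / q ^ Suc i < 0"
    using q by (intro divide_neg_pos) auto
  then show ?thesis using lex_bounded_gap[OF assms(1) i] by linarith
qed

lemma lex_bounded_small_tails:
  assumes "c \<in> digit_seqs M" "\<And>n. c n < M \<Longrightarrow> lex_le (shift (Suc n) c) a"
  shows "small_tails M q c"
  unfolding small_tails_def
proof safe
  fix n assume n: "c n < M"
  show "val q (shift (Suc n) c) \<le> 1"
  proof (rule lex_bounded_val_le)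
    show "lex_le (shift (Suc m) (shift (Suc n) c)) a" if "shift (Suc n) c m < M" for m
    proof -
      have "c (Suc n + m) < M" using that by (simp add: shift_apply)
      from assms(2)[OF this] show ?thesis by simp
    qed
  qed (use assms n in auto)
qed

end

section \<open>Existence and characterization of quasi-greedy expansions\<close>

context
  fixes M :: nat and q :: real
  assumes q: "1 < q" "q \<le> real M + 1"
begin

lemma one_le_max_val: "1 \<le> real M / (q - 1)"
  using q by simp

lemma quasi_greedy_digits_exist:
  assumes "0 \<le> x" "x \<le> real M / (q - 1)"
  shows "\<exists>c. c \<in> digit_seqs M \<and> infinite_seq c \<and> val q c = x \<and> small_tails M q c"
proof (cases "x = 0")
  \<comment> \<open>For 0 no digit leaves a positive remainder; its expansion is the zero sequence,
    which counts as infinite.\<close>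
  case True
  have "val q (\<lambda>_. 0) = 0" by (simp add: val_def)
  moreover have "shift n (\<lambda>_. 0) = (\<lambda>_. 0)" for n by (simp add: shift_def)
  ultimately show ?thesis
    using True by (intro exI[of _ "\<lambda>_. 0"]) (auto simp: digit_seqs_def finite_seq_def small_tails_def)
next
  case False
  \<comment> \<open>For \<open>y > 0\<close>, \<open>dig y\<close> is the largest digit strictly
    below \<open>q * y\<close>, so the remainder \<open>f y\<close> never reaches 0 and the
    expansion is infinite. The bound \<open>K\<close> is the fixed point of subtracting the digit
    \<open>M\<close>, which keeps remainders in range.\<close>
  define dig where "dig y = min M (nat (\<lceil>q * y\<rceil> - 1))" for y
  define f where "f y = q * y - real (dig y)" for y
  define K where "K = real M / (q - 1)"
  have K: "1 \<le> K" "q * K = K + real M" using q by (auto simp: K_def field_simps)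
  have small: "f y \<le> 1" if "dig y < M" "0 < y" for y
  proof -
    have "0 < q * y" using that q by simp
    then have "dig y = nat (\<lceil>q * y\<rceil> - 1)" "0 < \<lceil>q * y\<rceil>" using that by (auto simp: dig_def)
    then have "real (dig y) = of_int \<lceil>q * y\<rceil> - 1" by simp
    then show ?thesis unfolding f_def by linarith
  qed
  have f_range: "0 < f y \<and> f y \<le> K" if "0 < y" "y \<le> K" for y
  proof
    have "0 < q * y" using that q by simp
    then have "0 < \<lceil>q * y\<rceil>" by simp
    then have "real (nat (\<lceil>q * y\<rceil> - 1)) < q * y" by linarith
    then show "0 < f y" by (auto simp: f_def dig_def min_def)
    show "f y \<le> K"
    proof (cases "dig y < M")
      case True
      then show ?thesis using small that K by fastforce
    next
      case False
      then have "dig y = M" by (simp add: dig_def)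
      moreover have "q * y \<le> q * K" using that q by simp
      ultimately show ?thesis using K by (simp add: f_def)
    qed
  qed
  define c where "c x i = dig ((f ^^ i) x)" for x i
  have dig_c: "c x \<in> digit_seqs M" for x by (auto simp: digit_seqs_def c_def dig_def)
  have y: "0 < (f ^^ n) x \<and> (f ^^ n) x \<le> K" if "0 < x" "x \<le> K" for n x
    by (induction n) (use that f_range in auto)
  have val_c: "val q (c x) = x" if x: "0 < x" "x \<le> K" for x
  proof -
    have part: "(\<Sum>i<n. real (c x i) / q ^ Suc i) = x - (f ^^ n) x / q ^ n" for n
    proof (induction n)
      case (Suc n)
      have "(f ^^ Suc n) x / q ^ Suc n = (f ^^ n) x / q ^ n - real (c x n) / q ^ Suc n"
        using q by (simp add: f_def c_def diff_divide_distrib)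
      then show ?case using Suc by simp
    qed simp
    have "(\<lambda>n. (f ^^ n) x / q ^ n) \<longlonglongrightarrow> 0"
    proof (rule tendsto_sandwich[of "\<lambda>_. 0" _ _ "\<lambda>n. K / q ^ n"])
      show "\<forall>\<^sub>F n in sequentially. 0 \<le> (f ^^ n) x / q ^ n" using y[OF x] q by (simp add: less_imp_le)
      show "\<forall>\<^sub>F n in sequentially. (f ^^ n) x / q ^ n \<le> K / q ^ n"
        using y[OF x] q by (intro always_eventually allI divide_right_mono) auto
      show "(\<lambda>n. K / q ^ n) \<longlonglongrightarrow> 0" using q by (intro LIMSEQ_divide_realpow_zero) auto
    qed simp
    then have "(\<lambda>n. \<Sum>i<n. real (c x i) / q ^ Suc i) \<longlonglongrightarrow> x - 0" unfolding part
      by (intro tendsto_intros)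
    then have "(\<lambda>i. real (c x i) / q ^ Suc i) sums x" by (simp add: sums_def)
    then show ?thesis unfolding val_def by (simp add: sums_iff)
  qed
  have shift_c: "shift n (c x) = c ((f ^^ n) x)" for n x
    by (simp add: fun_eq_iff c_def funpow_add add.commute shift_apply)
  have x: "0 < x" "x \<le> K" using False assms by (auto simp: K_def)
  have tail: "val q (shift n (c x)) = (f ^^ n) x" for n
    using val_c y[OF x] by (simp add: shift_c)
  have "small_tails M q (c x)"
    unfolding small_tails_def
  proof safe
    fix n assume "c x n < M"
    then have "f ((f ^^ n) x) \<le> 1" using small y[OF x] by (simp add: c_def)
    then show "val q (shift (Suc n) (c x)) \<le> 1" unfolding tail by simp
  qed
  moreover have "infinite_seq (c x)"
  proof
    assume "finite_seq (c x)"
    then obtain n where "\<forall>i>n. c x i = 0" by (auto simp: finite_seq_def)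
    then have "shift (Suc n) (c x) = (\<lambda>_. 0)" by (auto simp: shift_apply)
    then have "val q (shift (Suc n) (c x)) = 0" by (simp add: val_def)
    then show False using tail y[OF x] by (metis less_irrefl)
  qed
  ultimately show ?thesis using dig_c val_c[OF x] by blast
qed

lemma small_tails_greatest:
  assumes "c \<in> digit_seqs M" "small_tails M q c" "d \<in> digit_seqs M" "infinite_seq d" "val q d = val q c"
  shows "lex_le d c"
  using small_tails_less[OF assms(1-4) q(1)] assms(5) by (metis less_irrefl not_lex_le)

text \<open>Small tails make an infinite expansion the greatest one; conversely, the greatest one
  has to coincide with the one constructed in \<open>quasi_greedy_digits_exist\<close>.\<close>

lemma is_quasi_greedy_iff:
  "is_quasi_greedy M q x c \<longleftrightarrow>
    c \<in> digit_seqs M \<and> infinite_seq c \<and> val q c = x \<and> small_tails M q c" (is "?L \<longleftrightarrow> ?R c")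
proof
  assume R: "?R c"
  then have "lex_le d c" if "is_expansion M q x d" "infinite_seq d" for d
    using that small_tails_greatest by (auto simp: is_expansion_iff[OF q(1)])
  then show ?L using R by (auto simp: is_quasi_greedy_def is_expansion_iff[OF q(1)] lex_le_def)
next
  assume L: ?L
  then have c: "c \<in> digit_seqs M" "infinite_seq c" "val q c = x"
    by (auto simp: is_quasi_greedy_def is_expansion_iff[OF q(1)])
  obtain d where d: "?R d"
    using quasi_greedy_digits_exist[of x] val_nonneg[OF c(1) q(1)] val_le[OF c(1) q(1)] c(3) by auto
  then have "lex_le d c" using L by (auto simp: is_quasi_greedy_def is_expansion_iff[OF q(1)] lex_le_def)
  moreover have "lex_le c d" using small_tails_greatest d c by metis
  ultimately show "?R c" using d lex_le_antisym by metis
qed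

lemma quasi_greedy_eq:
  assumes "c \<in> digit_seqs M" "infinite_seq c" "small_tails M q c"
  shows "quasi_greedy M q (val q c) = c"
  unfolding quasi_greedy_def
proof (rule the_equality)
  show "is_quasi_greedy M q (val q c) c" using assms by (simp add: is_quasi_greedy_iff)
  show "d = c" if "is_quasi_greedy M q (val q c) d" for d
    using that assms small_tails_greatest[of c d] small_tails_greatest[of d c] lex_le_antisym
    by (auto simp: is_quasi_greedy_iff)
qed

lemma quasi_greedy:
  assumes "x \<in> J M q"
  shows "quasi_greedy M q x \<in> digit_seqs M" "infinite_seq (quasi_greedy M q x)"
    "val q (quasi_greedy M q x) = x" "small_tails M q (quasi_greedy M q x)"
proof -
  obtain c where c: "c \<in> digit_seqs M" "infinite_seq c" "val q c = x" "small_tails M q c"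
    using quasi_greedy_digits_exist[of x] assms by (auto simp: J_def)
  then have "quasi_greedy M q x = c" using quasi_greedy_eq by blast
  then show "quasi_greedy M q x \<in> digit_seqs M" "infinite_seq (quasi_greedy M q x)"
    "val q (quasi_greedy M q x) = x" "small_tails M q (quasi_greedy M q x)" using c by auto
qed

lemma val_in_J: "c \<in> digit_seqs M \<Longrightarrow> val q c \<in> J M q"
  using val_nonneg val_le q(1) by (auto simp: J_def)

end

section \<open>Lexicographic characterizations\<close>

text \<open>The \<open>a(q)\<close> of the overview.\<close>

definition alpha :: "nat \<Rightarrow> real \<Rightarrow> nat \<Rightarrow> nat" where
  "alpha M q = quasi_greedy M q 1"

lemma lex_le_const_max:
  assumes "lex_le (\<lambda>_. M) c" "c \<in> digit_seqs M"
  shows "c = (\<lambda>_. M)"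
  using assms digit_seqs_le[OF assms(2)] by (auto simp: lex_le_def less_fun_def not_less[symmetric])

lemma weak_adm_reflect:
  assumes "c \<in> digit_seqs M"
  shows "weak_adm M a (reflect M c) \<longleftrightarrow> weak_adm M a c"
proof -
  have "reflect M c n < M \<longleftrightarrow> 0 < c n" "0 < reflect M c n \<longleftrightarrow> c n < M" for n
    using digit_seqs_le[OF assms, of n] by (auto simp: reflect_apply)
  then show ?thesis
    using reflect_reflect[OF digit_seqs_shift[OF assms]] unfolding weak_adm_def by auto
qed

lemma strict_adm_reflect:
  assumes "c \<in> digit_seqs M"
  shows "strict_adm M a (reflect M c) \<longleftrightarrow> strict_adm M a c"
proof -
  have "reflect M c n < M \<longleftrightarrow> 0 < c n" "0 < reflect M c n \<longleftrightarrow> c n < M" for n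
    using digit_seqs_le[OF assms, of n] by (auto simp: reflect_apply)
  then show ?thesis
    using reflect_reflect[OF digit_seqs_shift[OF assms]] unfolding strict_adm_def by auto
qed

lemma doubly_infinite_iff: "doubly_infinite_seq M c \<longleftrightarrow> infinite_seq c \<and> infinite_seq (reflect M c)"
  by (simp add: doubly_infinite_seq_def reflect_def)

lemma finite_seq_reflected_tail:
  assumes "finite_seq c"
  obtains n where "0 < c n" "reflect M (shift (Suc n) c) = (\<lambda>_. M)"
proof -
  obtain n where "0 < c n" "\<And>i. n < i \<Longrightarrow> c i = 0" using assms by (auto simp: finite_seq_def)
  then show ?thesis by (intro that[of n]) (auto simp: reflect_def shift_def)
qed

context
  fixes M :: nat and q :: real
  assumes M: "0 < M" and q: "1 < q" "q \<le> real M + 1"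
begin

lemma one_in_J: "1 \<in> J M q"
  using one_le_max_val[OF q] by (simp add: J_def)

lemmas alpha_digits = quasi_greedy(1)[OF q one_in_J, folded alpha_def]
  and alpha_infinite = quasi_greedy(2)[OF q one_in_J, folded alpha_def]
  and alpha_val = quasi_greedy(3)[OF q one_in_J, folded alpha_def]
  and alpha_small_tails = quasi_greedy(4)[OF q one_in_J, folded alpha_def]

lemma alpha_head_pos: "0 < alpha M q 0"
proof (rule ccontr)
  assume "\<not> 0 < alpha M q 0"
  then have z: "alpha M q 0 = 0" by simp
  then have "val q (shift (Suc 0) (alpha M q)) \<le> 1"
    using alpha_small_tails M by (simp add: small_tails_def)
  moreover have "1 = val q (shift (Suc 0) (alpha M q)) / q"
    using val_Suc[OF alpha_digits q(1)] alpha_val z by simp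
  ultimately show False using q(1) by (simp add: field_simps)
qed

lemma alpha_eqI:
  assumes "s \<in> digit_seqs M" "infinite_seq s" "val q s = 1"
    "\<And>n. s n < M \<Longrightarrow> lex_le (shift (Suc n) s) s"
  shows "alpha M q = s"
  using quasi_greedy_eq[OF q assms(1,2)] lex_bounded_small_tails[OF q(1) assms(1,3) assms(1,4)]
    assms(3) by (simp add: alpha_def)

text \<open>Since \<open>alpha M q\<close> has small tails and value 1, a tail above it would have
  value greater than 1.\<close>

lemma small_tails_imp_lex_le:
  assumes "c \<in> digit_seqs M" "infinite_seq c" "small_tails M q c" "c n < M"
  shows "lex_le (shift (Suc n) c) (alpha M q)"
proof (rule ccontr)
  assume "\<not> ?thesis"
  then have "val q (alpha M q) < val q (shift (Suc n) c)"
    using assms alpha_digits alpha_small_tails infinite_seq_shift q(1)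
    by (intro small_tails_less) auto
  then show False using assms(3,4) alpha_val by (auto simp: small_tails_def)
qed

lemma alpha_shift_le: "lex_le (shift n (alpha M q)) (alpha M q)"
  using self_bounded_shift[OF alpha_digits]
    small_tails_imp_lex_le[OF alpha_digits alpha_infinite alpha_small_tails] by blast

lemma weak_adm_small_tails:
  assumes "c \<in> digit_seqs M" "weak_adm M (alpha M q) c"
  shows "small_tails M q c"
  using lex_bounded_small_tails[OF q(1) alpha_digits alpha_val assms(1)] assms(2)
  by (auto simp: weak_adm_def)

lemma strict_tail_val:
  assumes c: "c \<in> digit_seqs M" "strict_adm M (alpha M q) c" "c n < M"
  shows "val q (shift (Suc n) c) < 1"
proof (rule lex_bounded_val_less[OF q(1) alpha_digits alpha_val])
  have weak: "lex_le (shift (Suc m) c) (alpha M q)" if "c m < M" for m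
    using strict_adm_imp_weak_adm[OF c(2)] that by (auto simp: weak_adm_def)
  show "lex_le (shift (Suc m) (shift (Suc n) c)) (alpha M q)" if "shift (Suc n) c m < M" for m
    using weak[of "Suc n + m"] that by (auto simp: shift_apply[of "Suc n" c m])
qed (use c alpha_infinite in \<open>auto simp: strict_adm_def\<close>)

text \<open>If the tail had value at least 1, raising the digit before it and expanding the tail
  value minus 1 would give a second expansion.\<close>

lemma unique_expansion_small_tail:
  assumes c: "c \<in> digit_seqs M" and n: "c n < M"
    and uniq: "\<And>d. d \<in> digit_seqs M \<Longrightarrow> val q d = val q c \<Longrightarrow> d = c"
  shows "val q (shift (Suc n) c) < 1"
proof (rule ccontr)
  assume "\<not> ?thesis"
  then have "0 \<le> val q (shift (Suc n) c) - 1" by simp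
  moreover have "val q (shift (Suc n) c) - 1 \<le> real M / (q - 1)"
    using val_le[OF digit_seqs_shift[OF c] q(1), of "Suc n"] by simp
  ultimately obtain e where e: "e \<in> digit_seqs M" "val q e = val q (shift (Suc n) c) - 1"
    using quasi_greedy_digits_exist[OF q] by blast
  define d where "d i = (if i < n then c i else if i = n then Suc (c n) else e (i - Suc n))" for i
  have d: "d \<in> digit_seqs M" using c e(1) n by (auto simp: d_def digit_seqs_def)
  have "shift (Suc n) d = e" by (auto simp: d_def shift_def)
  then have "val q d = val q c"
    using val_diff[OF c d q(1), of n] e(2) by (simp add: d_def)
  then have "d = c" using uniq d by blast
  then have "d n = c n" by simp
  then show False by (simp add: d_def)
qed

text \<open>Here the tail of \<open>d\<close> may vanish, so strictness has to come from the tails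
  of \<open>c\<close>.\<close>

lemma small_tails_imp_not_less:
  assumes "c \<in> digit_seqs M" "d \<in> digit_seqs M" "val q d = val q c"
    "\<And>n. c n < M \<Longrightarrow> val q (shift (Suc n) c) < 1"
  shows "\<not> less_fun c d"
proof
  assume "less_fun c d"
  then obtain i where i: "c i < d i" "\<And>j. j < i \<Longrightarrow> c j = d j" by (auto elim: less_funE)
  have "val q (shift (Suc i) c) < 1"
    using i(1) digit_seqs_le[OF assms(2), of i] by (intro assms(4)) simp
  moreover have "0 \<le> val q (shift (Suc i) d)" using assms(2) val_nonneg q(1) digit_seqs_shift by blast
  moreover have "1 \<le> real (d i) - real (c i)" using i(1) by linarith
  ultimately have "0 < (real (d i) - real (c i) + val q (shift (Suc i) d) - val q (shift (Suc i) c)) / q ^ Suc i"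
    using q(1) by (intro divide_pos_pos) auto
  moreover have "val q d - val q c =
      (real (d i) - real (c i) + val q (shift (Suc i) d) - val q (shift (Suc i) c)) / q ^ Suc i"
    using i(2) by (rule val_diff[OF assms(1,2) q(1)])
  ultimately show False using assms(3) by linarith
qed

text \<open>Reflection turns smaller competitors into larger ones and preserves strict
  admissibility, so one comparison serves both sides.\<close>

lemma strict_adm_unique:
  assumes c: "c \<in> digit_seqs M" "strict_adm M (alpha M q) c" and d: "d \<in> digit_seqs M" "val q d = val q c"
  shows "d = c"
proof -
  have "\<not> less_fun c d"
    using small_tails_imp_not_less[OF c(1) d] strict_tail_val[OF c] by blast
  moreover have "\<not> less_fun d c"
  proof
    assume "less_fun d c"
    then have "less_fun (reflect M c) (reflect M d)" using less_fun_reflect c(1) by blast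
    moreover have "\<not> less_fun (reflect M c) (reflect M d)"
    proof (rule small_tails_imp_not_less)
      show "val q (reflect M d) = val q (reflect M c)"
        using d c(1) q(1) by (simp add: val_reflect)
      show "val q (shift (Suc n) (reflect M c)) < 1" if "reflect M c n < M" for n
        using strict_tail_val[of "reflect M c" n] that c strict_adm_reflect by simp
    qed simp_all
    ultimately show False by simp
  qed
  ultimately show ?thesis using lex_cases by blast
qed

text \<open>A unique expansion is its own quasi-greedy expansion, so its tails are at most
  \<open>alpha M q\<close>; a tail value below 1 excludes equality. The reflected expansion gives
  the other half.\<close>

lemma unique_imp_strict_adm:
  assumes c: "c \<in> digit_seqs M" and uniq: "\<And>d. d \<in> digit_seqs M \<Longrightarrow> val q d = val q c \<Longrightarrow> d = c"
  shows "strict_adm M (alpha M q) c \<and> infinite_seq c"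
proof -
  have less: "less_fun (shift (Suc n) c) (alpha M q)"
    if c: "c \<in> digit_seqs M" and n: "c n < M"
      and uniq: "\<And>d. d \<in> digit_seqs M \<Longrightarrow> val q d = val q c \<Longrightarrow> d = c" for c n
  proof -
    have "val q c \<in> J M q" using val_in_J q c by blast
    then have qg: "quasi_greedy M q (val q c) = c" using quasi_greedy[OF q] uniq by blast
    have "infinite_seq c" "small_tails M q c"
      using quasi_greedy[OF q \<open>val q c \<in> J M q\<close>] by (simp_all add: qg)
    then have "lex_le (shift (Suc n) c) (alpha M q)" using small_tails_imp_lex_le c n by blast
    moreover have "val q (shift (Suc n) c) < 1" using unique_expansion_small_tail c n uniq by blast
    ultimately show ?thesis using alpha_val by (auto simp: lex_le_def)
  qed
  have "val q c \<in> J M q" using val_in_J q c by blast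
  then have "quasi_greedy M q (val q c) = c" using quasi_greedy[OF q] uniq by blast
  then have "infinite_seq c" using quasi_greedy[OF q \<open>val q c \<in> J M q\<close>] by simp
  moreover have "less_fun (reflect M (shift (Suc n) c)) (alpha M q)" if "0 < c n" for n
  proof -
    have "less_fun (shift (Suc n) (reflect M c)) (alpha M q)"
    proof (rule less)
      show "reflect M c n < M" using M that by (simp add: reflect_apply)
      fix d assume d: "d \<in> digit_seqs M" "val q d = val q (reflect M c)"
      then have "reflect M d = c" using c q(1) by (intro uniq) (simp_all add: val_reflect)
      then show "d = reflect M c" using d(1) by auto
    qed simp
    then show ?thesis by simp
  qed
  ultimately show ?thesis using less[OF c _ uniq] by (simp add: strict_adm_def)
qed

lemma ex1_expansion_iff:
  assumes "c \<in> digit_seqs M"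
  shows "(\<exists>!d. is_expansion M q (val q c) d) \<longleftrightarrow>
    (\<forall>d. d \<in> digit_seqs M \<longrightarrow> val q d = val q c \<longrightarrow> d = c)"
  unfolding is_expansion_iff[OF q(1)] using assms by blast

lemma ex1_expansion_iff_strict_adm:
  assumes "c \<in> digit_seqs M"
  shows "(\<exists>!d. is_expansion M q (val q c) d) \<longleftrightarrow> strict_adm M (alpha M q) c"
  unfolding ex1_expansion_iff[OF assms]
  using unique_imp_strict_adm[OF assms] strict_adm_unique[OF assms] by blast

lemma univoque_seqs_eq: "univoque_seqs M q = {c \<in> digit_seqs M. strict_adm M (alpha M q) c}"
proof (intro equalityI subsetI)
  fix c assume "c \<in> univoque_seqs M q"
  then obtain x where x: "x \<in> J M q" "\<exists>!c. is_expansion M q x c" "c = quasi_greedy M q x"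
    by (auto simp: univoque_seqs_def univoque_set_def)
  then have c: "c \<in> digit_seqs M" "val q c = x" using quasi_greedy[OF q x(1)] by auto
  then show "c \<in> {c \<in> digit_seqs M. strict_adm M (alpha M q) c}"
    using ex1_expansion_iff_strict_adm[OF c(1)] x(2) by simp
next
  fix c assume "c \<in> {c \<in> digit_seqs M. strict_adm M (alpha M q) c}"
  then have c: "c \<in> digit_seqs M" "strict_adm M (alpha M q) c" by auto
  define x where "x = val q c"
  have x: "x \<in> J M q" using val_in_J[OF q c(1)] by (simp add: x_def)
  then have "quasi_greedy M q x = c"
    using strict_adm_unique[OF c] quasi_greedy[OF q x] by (simp add: x_def)
  moreover have "\<exists>!d. is_expansion M q x d"
    unfolding x_def ex1_expansion_iff_strict_adm[OF c(1)] by (rule c(2))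
  ultimately show "c \<in> univoque_seqs M q"
    unfolding univoque_seqs_def univoque_set_def using x by blast
qed

lemma univoque_bases_iff: "q \<in> univoque_bases M \<longleftrightarrow> strict_adm M (alpha M q) (alpha M q)"
  using ex1_expansion_iff_strict_adm[OF alpha_digits] q(1)
  by (simp add: univoque_bases_def alpha_val)

lemma const_max_val_gt: "q < real M + 1 \<Longrightarrow> 1 < val q (\<lambda>_. M)"
  using q(1) by (simp add: val_const)

lemma alpha_ne_const: "q < real M + 1 \<Longrightarrow> alpha M q \<noteq> (\<lambda>_. M)"
  using const_max_val_gt alpha_val by fastforce

text \<open>The zeros after a last nonzero digit reflect to a constant \<open>M\<close>, which
  \<open>alpha M q\<close> can bound only in the largest base.\<close>

lemma weak_adm_infinite:
  assumes "weak_adm M (alpha M q) c" "q < real M + 1"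
  shows "infinite_seq c"
proof
  assume "finite_seq c"
  then obtain n where n: "0 < c n" "reflect M (shift (Suc n) c) = (\<lambda>_. M)"
    by (rule finite_seq_reflected_tail[where M = M]) blast
  then have "lex_le (reflect M (shift (Suc n) c)) (alpha M q)"
    using assms(1) unfolding weak_adm_def by blast
  then have "lex_le (\<lambda>_. M) (alpha M q)" unfolding n(2) .
  then show False using lex_le_const_max alpha_digits alpha_ne_const assms(2) by blast
qed

lemma small_tails_infinite_reflect:
  assumes c: "c \<in> digit_seqs M" "small_tails M q c" and "q < real M + 1"
  shows "infinite_seq (reflect M c)"
proof
  assume "finite_seq (reflect M c)"
  then obtain n where n: "0 < reflect M c n" "reflect M (shift (Suc n) (reflect M c)) = (\<lambda>_. M)"
    by (rule finite_seq_reflected_tail[where M = M]) blast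
  have "c n < M" using n(1) by (simp add: reflect_apply)
  then have "val q (shift (Suc n) c) \<le> 1" using c(2) by (simp add: small_tails_def)
  moreover have "shift (Suc n) c = (\<lambda>_. M)" using n(2) c(1) by simp
  ultimately show False using const_max_val_gt[OF assms(3)] by simp
qed

text \<open>The quasi-greedy expansion is the largest doubly infinite one, and the reflected
  quasi-greedy expansion of the mirrored point \<open>x'\<close> is the smallest. Uniqueness means
  that they coincide, so that both the sequence and its reflection have small tails.\<close>

lemma bi_unique_iff:
  assumes x: "x \<in> J M q" and less: "q < real M + 1"
  shows "(\<exists>!c. is_expansion M q x c \<and> doubly_infinite_seq M c) \<longleftrightarrow>
    weak_adm M (alpha M q) (quasi_greedy M q x)"
proof
  define g where "g = quasi_greedy M q x"
  note g = quasi_greedy[OF q x, folded g_def]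
  have dg: "is_expansion M q x g" "doubly_infinite_seq M g"
    using g small_tails_infinite_reflect less by (auto simp: is_expansion_iff[OF q(1)] doubly_infinite_iff)
  {
    assume L: "\<exists>!c. is_expansion M q x c \<and> doubly_infinite_seq M c"
    define x' where "x' = real M / (q - 1) - x"
    have x': "x' \<in> J M q" using x by (auto simp: x'_def J_def)
    define h where "h = quasi_greedy M q x'"
    note h = quasi_greedy[OF q x', folded h_def]
    have "is_expansion M q x (reflect M h)" "doubly_infinite_seq M (reflect M h)"
      using h small_tails_infinite_reflect less q(1)
      by (auto simp: is_expansion_iff[OF q(1)] doubly_infinite_iff val_reflect x'_def)
    then have "reflect M h = g" using L dg by blast
    then have rg: "reflect M g = h" using h(1) by auto
    have "lex_le (reflect M (shift (Suc n) g)) (alpha M q)" if "0 < g n" for n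
      using small_tails_imp_lex_le[OF h(1,2,4), of n] that M
      by (simp add: rg[symmetric] reflect_apply)
    then show "weak_adm M (alpha M q) g"
      using small_tails_imp_lex_le[OF g(1,2,4)] by (simp add: weak_adm_def)
  }
  assume R: "weak_adm M (alpha M q) g"
  have st: "small_tails M q (reflect M g)"
    using weak_adm_small_tails[of "reflect M g"] R g(1) weak_adm_reflect by simp
  show "\<exists>!c. is_expansion M q x c \<and> doubly_infinite_seq M c"
  proof (rule ex1I[of _ g])
    show "is_expansion M q x g \<and> doubly_infinite_seq M g" using dg by simp
  next
    fix d assume "is_expansion M q x d \<and> doubly_infinite_seq M d"
    then have d: "d \<in> digit_seqs M" "val q d = x" "infinite_seq d" "infinite_seq (reflect M d)"
      by (auto simp: is_expansion_iff[OF q(1)] doubly_infinite_iff)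
    have "lex_le d g" using small_tails_greatest[OF q g(1,4) d(1,3)] d(2) g(3) by simp
    moreover have "lex_le (reflect M d) (reflect M g)"
      using d g q(1) by (intro small_tails_greatest[OF q _ st]) (auto simp: val_reflect)
    then have "lex_le g d" using lex_le_reflect[of "reflect M d" "reflect M g" M] d(1) g(1) by simp
    ultimately show "d = g" by (rule lex_le_antisym)
  qed
qed

lemma bi_univoque_seqs_eq:
  assumes "q < real M + 1"
  shows "bi_univoque_seqs M q = {c \<in> digit_seqs M. weak_adm M (alpha M q) c}"
proof -
  have eq: "bi_univoque_seqs M q = quasi_greedy M q ` {x \<in> J M q. weak_adm M (alpha M q) (quasi_greedy M q x)}"
    using assms bi_unique_iff by (auto simp: bi_univoque_seqs_def bi_univoque_set_def)
  show ?thesis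
    unfolding eq
  proof safe
    fix c assume c: "c \<in> digit_seqs M" "weak_adm M (alpha M q) c"
    have "quasi_greedy M q (val q c) = c"
      using c weak_adm_infinite weak_adm_small_tails assms by (intro quasi_greedy_eq[OF q])
    then show "c \<in> quasi_greedy M q ` {x \<in> J M q. weak_adm M (alpha M q) (quasi_greedy M q x)}"
      using c val_in_J[OF q] by (intro image_eqI[of _ _ "val q c"]) auto
  qed (use quasi_greedy[OF q] in auto)
qed

lemma bi_univoque_bases_iff_less:
  "q < real M + 1 \<Longrightarrow> q \<in> bi_univoque_bases M \<longleftrightarrow> bi_adm M (alpha M q)"
  using bi_unique_iff[OF one_in_J] bi_adm_iff_weak_adm[OF alpha_digits alpha_head_pos] q(1)
  by (simp add: bi_univoque_bases_def alpha_def)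

end

section \<open>The largest base\<close>

context
  fixes M :: nat
  assumes M: "0 < M"
begin

lemma unique_expansion_max: "is_expansion M (real M + 1) 1 c \<longleftrightarrow> c = (\<lambda>_. M)"
proof
  have q: "1 < real M + 1" using M by simp
  {
    assume "is_expansion M (real M + 1) 1 c"
    then have c: "c \<in> digit_seqs M" "val (real M + 1) c = 1" by (auto simp: is_expansion_iff[OF q])
    then have "val (real M + 1) (reflect M c) = 0" using M q by (simp add: val_reflect)
    then have "reflect M c n = 0" for n using val_pos[of "reflect M c" M _ n] q by fastforce
    then show "c = (\<lambda>_. M)"
      using digit_seqs_le[OF c(1)] by (auto simp: reflect_apply fun_eq_iff intro: antisym)
  }
  assume "c = (\<lambda>_. M)"
  then show "is_expansion M (real M + 1) 1 c"
    using M q by (simp add: is_expansion_iff[OF q] val_const digit_seqs_def)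
qed

lemma alpha_max: "alpha M (real M + 1) = (\<lambda>_. M)"
proof -
  have "is_expansion M (real M + 1) 1 (alpha M (real M + 1))"
    using alpha_digits[of M "real M + 1"] alpha_val[of M "real M + 1"] M by (simp add: is_expansion_iff)
  then show ?thesis by (simp add: unique_expansion_max)
qed

lemma bi_adm_const_max: "bi_adm M (\<lambda>_. M)"
proof -
  have "shift n (\<lambda>_. M) = (\<lambda>_. M)" for n by (simp add: shift_def)
  moreover have "less_fun (reflect M (\<lambda>_. M)) (\<lambda>_. M)"
    using M by (intro less_funI2[of _ 0]) (auto simp: reflect_apply)
  ultimately show ?thesis by (simp add: bi_adm_def digit_seqs_def lex_le_def)
qed

lemma max_in_bi_univoque: "real M + 1 \<in> bi_univoque_bases M"
proof -
  have "infinite_seq (\<lambda>_. M)" "infinite_seq (\<lambda>i. M - M)" using M by (auto simp: finite_seq_def)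
  then show ?thesis
    using M unique_expansion_max by (auto simp: bi_univoque_bases_def doubly_infinite_seq_def)
qed

text \<open>In this base every tail has value at most 1, so small tails are automatic. The weak
  bounds by the constant \<open>M\<close> would admit finite sequences as well, hence the separate
  description.\<close>

lemma bi_univoque_seqs_max: "bi_univoque_seqs M (real M + 1) = {c \<in> digit_seqs M. infinite_seq c}"
proof -
  let ?q = "real M + 1"
  have q: "1 < ?q" "?q \<le> real M + 1" using M by auto
  have J: "J M ?q = {0..1}" using M by (simp add: J_def)
  show ?thesis
    unfolding bi_univoque_seqs_def bi_univoque_set_def
  proof (simp add: J[symmetric], safe)
    fix c assume c: "c \<in> digit_seqs M" "infinite_seq c"
    have "small_tails M ?q c"
      using val_le[OF digit_seqs_shift[OF c(1)] q(1)] M by (simp add: small_tails_def)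
    then have "quasi_greedy M ?q (val ?q c) = c" using quasi_greedy_eq[OF q c] by simp
    then show "c \<in> quasi_greedy M ?q ` J M ?q"
      using val_in_J[OF q c(1)] by (metis image_eqI)
  qed (use quasi_greedy[OF q] in auto)
qed

lemma no_expansion_above_max:
  assumes "real M + 1 < q"
  shows "\<not> is_expansion M q 1 c"
proof
  assume "is_expansion M q 1 c"
  then have "1 \<le> real M / (q - 1)" using val_le[of c M q] assms by (simp add: is_expansion_iff)
  then show False using assms by (simp add: field_simps)
qed

lemma bi_univoque_bases_iff:
  "q \<in> bi_univoque_bases M \<longleftrightarrow> q \<in> {1<..real M + 1} \<and> bi_adm M (alpha M q)"
proof -
  consider "q \<le> 1" | "1 < q" "q < real M + 1" | "q = real M + 1" | "real M + 1 < q" by linarith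
  then show ?thesis
  proof cases
    case 1
    then show ?thesis by (auto simp: bi_univoque_bases_def)
  next
    case 2
    then show ?thesis using bi_univoque_bases_iff_less[OF M] by auto
  next
    case 3
    then show ?thesis using max_in_bi_univoque alpha_max bi_adm_const_max M by auto
  next
    case 4
    then show ?thesis using no_expansion_above_max by (auto simp: bi_univoque_bases_def)
  qed
qed

lemma univoque_bases_range: "univoque_bases M \<subseteq> {1<..real M + 1}"
  using no_expansion_above_max by (force simp: univoque_bases_def)

end

section \<open>The order structure of the sets of bases\<close>

definition left_limit :: "real set \<Rightarrow> real \<Rightarrow> bool" where
  "left_limit V q \<longleftrightarrow> (\<forall>p<q. \<exists>v\<in>V. p < v \<and> v < q)"

definition right_limit :: "real set \<Rightarrow> real \<Rightarrow> bool" where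
  "right_limit V q \<longleftrightarrow> (\<forall>r>q. \<exists>v\<in>V. q < v \<and> v < r)"

lemma islimpt_real_cases: "q islimpt V \<Longrightarrow> left_limit V q \<or> right_limit V q" for q :: real
proof (rule ccontr)
  assume q: "q islimpt V" and "\<not> (left_limit V q \<or> right_limit V q)"
  then obtain p r where pr: "p < q" "\<And>v. v \<in> V \<Longrightarrow> \<not> (p < v \<and> v < q)"
    "q < r" "\<And>v. v \<in> V \<Longrightarrow> \<not> (q < v \<and> v < r)"
    by (auto simp: left_limit_def right_limit_def)
  obtain v where "v \<in> V" "v \<noteq> q" "v \<in> {p<..<r}"
    using q pr(1,3) by (auto elim!: islimptE[of _ _ "{p<..<r}"])
  then show False using pr(2,4)[of v] by auto
qed

context
  fixes M :: nat
  assumes M: "0 < M"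
begin

text \<open>In the larger base \<open>r\<close> the sequence \<open>alpha M q\<close> has value
  below 1, whereas small tails of \<open>alpha M r\<close> give every infinite sequence above it a
  value greater than 1.\<close>

lemma alpha_strict_mono:
  assumes "1 < q" "q < r" "r \<le> real M + 1"
  shows "less_fun (alpha M q) (alpha M r)"
proof (rule ccontr)
  have q: "1 < q" "q \<le> real M + 1" and r: "1 < r" "r \<le> real M + 1" using assms by auto
  assume "\<not> ?thesis"
  then have "lex_le (alpha M r) (alpha M q)" by (simp add: not_less_fun)
  moreover have less: "val r (alpha M q) < 1"
    using val_strict_antimono[OF alpha_digits[OF M q] assms(1,2) alpha_head_pos[OF M q]]
      alpha_val[OF M q] by simp
  moreover have "\<not> less_fun (alpha M r) (alpha M q)"
    using small_tails_less[OF alpha_digits[OF M r] alpha_small_tails[OF M r]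
      alpha_digits[OF M q] alpha_infinite[OF M q] r(1)] alpha_val[OF M r] less by auto
  ultimately show False using alpha_val[OF M r] by (auto simp: lex_le_def)
qed

lemma alpha_less_iff:
  assumes "q \<in> {1<..real M + 1}" "r \<in> {1<..real M + 1}"
  shows "less_fun (alpha M q) (alpha M r) \<longleftrightarrow> q < r"
proof
  assume less: "less_fun (alpha M q) (alpha M r)"
  show "q < r"
  proof (rule ccontr)
    assume "\<not> q < r"
    then have "r = q \<or> less_fun (alpha M r) (alpha M q)" using alpha_strict_mono assms by force
    then show False using less less_fun_asym less_fun_irrefl by metis
  qed
qed (use alpha_strict_mono assms in auto)

lemma alpha_le_iff:
  assumes "q \<in> {1<..real M + 1}" "r \<in> {1<..real M + 1}"
  shows "lex_le (alpha M q) (alpha M r) \<longleftrightarrow> q \<le> r"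
  using alpha_less_iff[OF assms(2,1)] not_less_fun by (metis not_less)

lemma bi_adm_infinite:
  assumes "bi_adm M s"
  shows "infinite_seq s"
proof
  assume fin: "finite_seq s"
  then obtain n where n: "0 < s n" "reflect M (shift (Suc n) s) = (\<lambda>_. M)"
    by (rule finite_seq_reflected_tail)
  then have "s = (\<lambda>_. M)"
    using bi_adm_reflect_le[OF assms, of "Suc n"] lex_le_const_max bi_adm_digits[OF assms] by simp
  then show False using fin M by (auto simp: finite_seq_def)
qed

text \<open>The first digit and one of the next two are positive, so the value in base
  \<open>p\<close> is at least \<open>1 / p + 1 / p ^ 3\<close>, which exceeds 1 for
  \<open>p = 5 / 4\<close>. This uniform bound gives the left end for the intermediate value theorem
  and keeps \<open>bi_univoque_bases\<close> away from 1.\<close>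

lemma bi_adm_val_gt:
  assumes "bi_adm M s"
  shows "1 < val (5 / 4) s"
proof -
  have d: "s \<in> digit_seqs M" using assms by (rule bi_adm_digits)
  have q: "(1 :: real) < 5 / 4" by simp
  have "val (5 / 4) s = (\<Sum>i<3. real (s i) / (5 / 4) ^ Suc i) + val (5 / 4) (shift 3 s) / (5 / 4) ^ 3"
    by (rule val_split[OF d q])
  moreover have "0 \<le> val (5 / 4) (shift 3 s)" using val_nonneg[OF digit_seqs_shift[OF d] q] .
  moreover have "(\<Sum>i<3. real (s i) / (5 / 4) ^ Suc i) = real (s 0) * (4/5) + real (s 1) * (16/25) + real (s 2) * (64/125)"
    by (simp add: eval_nat_numeral)
  moreover have "1 \<le> s 0" using bi_adm_head_pos[OF assms M] by simp
  moreover have "1 \<le> s 1 \<or> 1 \<le> s 2" using bi_adm_second_digit[OF assms M] by linarith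
  ultimately show ?thesis by (auto simp: field_simps)
qed

lemma val_continuous_on:
  assumes "c \<in> digit_seqs M" "1 < p"
  shows "continuous_on {p..r} (\<lambda>q. val q c)"
proof -
  \<comment> \<open>\<open>K\<close> lies strictly between \<open>1 / p\<close> and 1: the power
    series in \<open>1 / q\<close> converges at \<open>K\<close>, and all \<open>1 / q\<close> with
    \<open>p <= q\<close> are inside.\<close>
  define K where "K = 2 / (1 + p)"
  have K: "0 < K" "K < 1" "1 / p < K"
    using assms(2) by (auto simp: K_def field_simps)
  define f where "f z = (\<Sum>n. real (c n) * z ^ n)" for z :: real
  have summ: "summable (\<lambda>n. real (c n) * K ^ n)"
  proof (rule summable_comparison_test')
    show "summable (\<lambda>n. real M * K ^ n)" using K by (intro summable_mult summable_geometric) simp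
    show "norm (real (c n) * K ^ n) \<le> real M * K ^ n" if "0 \<le> n" for n
      using K digit_seqs_le[OF assms(1), of n] by (simp add: abs_mult)
  qed
  have cont: "isCont f z" if "\<bar>z\<bar> < K" for z
    unfolding f_def using isCont_powser[OF summ, of z] that K by simp
  have "val q c = 1 / q * f (1 / q)" if "p \<le> q" for q
  proof -
    have "1 < q" using that assms(2) by simp
    have "1 / q \<le> 1 / p" using that assms(2) by (intro divide_left_mono) auto
    then have "norm (1 / q) < norm K" using K \<open>1 < q\<close> by simp
    then have "summable (\<lambda>n. real (c n) * (1 / q) ^ n)"
      using powser_inside[OF summ] by blast
    then have "1 / q * f (1 / q) = (\<Sum>n. 1 / q * (real (c n) * (1 / q) ^ n))"
      unfolding f_def by (rule suminf_mult[symmetric])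
    then show ?thesis by (simp add: val_def power_divide)
  qed
  moreover have "continuous_on {p..r} (\<lambda>q. 1 / q * f (1 / q))"
  proof (intro continuous_at_imp_continuous_on ballI)
    fix q assume "q \<in> {p..r}"
    then have q: "p \<le> q" "0 < q" using assms(2) by auto
    then have "1 / q \<le> 1 / p" using assms(2) by (intro divide_left_mono) auto
    then have "\<bar>1 / q\<bar> < K" using K q by simp
    then have "isCont f (1 / q)" by (rule cont)
    moreover have inv: "isCont (\<lambda>q. 1 / q) q" using q by (intro continuous_intros) auto
    ultimately have "isCont (\<lambda>q. f (1 / q)) q" by (rule isCont_o2[rotated])
    then show "isCont (\<lambda>q. 1 / q * f (1 / q)) q" using inv by (intro continuous_mult)
  qed
  ultimately show ?thesis by (subst continuous_on_cong[OF refl]) auto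
qed

text \<open>The value of \<open>s\<close> exceeds 1 at \<open>5 / 4\<close> and is at most 1 at the
  largest base, so it equals 1 in between; the bounds of \<open>s\<close> on its own tails then make
  it quasi-greedy.\<close>

lemma bi_adm_imp_alpha:
  assumes "bi_adm M s"
  obtains v where "v \<in> bi_univoque_bases M" "alpha M v = s"
proof -
  have d: "s \<in> digit_seqs M" using assms by (rule bi_adm_digits)
  have "val (real M + 1) s \<le> 1" using val_le[OF d, of "real M + 1"] M by simp
  moreover have "continuous_on {5 / 4..real M + 1} (\<lambda>q. val q s)"
    by (rule val_continuous_on[OF d]) simp
  ultimately obtain v where v: "5 / 4 \<le> v" "v \<le> real M + 1" "val v s = 1"
    using IVT2'[of "\<lambda>q. val q s" "real M + 1" 1 "5 / 4"] bi_adm_val_gt[OF assms] M by auto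
  have "alpha M v = s"
    using v by (intro alpha_eqI[OF M _ _ d bi_adm_infinite[OF assms]] bi_adm_shift_le[OF assms]) auto
  moreover have "v \<in> bi_univoque_bases M"
    using v assms \<open>alpha M v = s\<close> by (auto simp: bi_univoque_bases_iff[OF M])
  ultimately show ?thesis using that by blast
qed

lemma bi_univoque_range: "v \<in> bi_univoque_bases M \<Longrightarrow> v \<in> {1<..real M + 1}"
  and bi_univoque_bi_adm: "v \<in> bi_univoque_bases M \<Longrightarrow> bi_adm M (alpha M v)"
  using bi_univoque_bases_iff[OF M] by blast+

lemma bi_univoque_ge: "v \<in> bi_univoque_bases M \<Longrightarrow> 5 / 4 \<le> v"
proof (rule ccontr)
  assume v: "v \<in> bi_univoque_bases M" and less: "\<not> 5 / 4 \<le> v"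
  have r: "1 < v" "v \<le> real M + 1" using bi_univoque_range[OF v] by auto
  have "val (5 / 4) (alpha M v) < val v (alpha M v)"
    using val_strict_antimono[OF alpha_digits[OF M r] r(1) _ alpha_head_pos[OF M r]] less by simp
  then show False using bi_adm_val_gt[OF bi_univoque_bi_adm[OF v]] alpha_val[OF M r] by simp
qed

text \<open>The supremum of the expansions for bases \<open>v < q\<close> is a limit of sequences
  satisfying \<open>bi_adm\<close>, hence itself the expansion of 1 in some base \<open>r\<close>;
  monotonicity leaves only \<open>r = q\<close>. This also gives digitwise convergence from the
  left.\<close>

lemma left_limit_bi_univoque:
  assumes q: "q \<in> {1<..real M + 1}" and lim: "left_limit (bi_univoque_bases M) q"
  shows "q \<in> bi_univoque_bases M"
    and "\<exists>v\<in>bi_univoque_bases M. v < q \<and> agree N (alpha M q) (alpha M v)"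
proof -
  define T where "T = alpha M ` {v \<in> bi_univoque_bases M. v < q}"
  obtain v0 where "v0 \<in> bi_univoque_bases M" "v0 < q" using lim q by (force simp: left_limit_def)
  then have "T \<noteq> {}" by (auto simp: T_def)
  moreover have "T \<subseteq> digit_seqs M"
    using bi_adm_digits bi_univoque_bi_adm by (auto simp: T_def)
  ultimately obtain s where s: "s \<in> digit_seqs M" "\<And>t. t \<in> T \<Longrightarrow> lex_le t s" "\<And>N. \<exists>t\<in>T. agree N s t"
    by (rule lex_sup_exists) blast
  have "bi_adm M s"
    using s(3) bi_univoque_bi_adm by (intro bi_adm_closed) (fastforce simp: T_def)
  then obtain r where r: "r \<in> bi_univoque_bases M" "alpha M r = s" by (rule bi_adm_imp_alpha)
  note rr = bi_univoque_range[OF r(1)]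
  have "v \<le> r" if "v \<in> bi_univoque_bases M" "v < q" for v
    using s(2)[of "alpha M v"] that r(2) alpha_le_iff[OF bi_univoque_range[OF that(1)] rr]
    by (auto simp: T_def)
  then have "\<not> r < q" using lim by (fastforce simp: left_limit_def)
  moreover have "\<not> q < r"
  proof
    assume "q < r"
    then have "less_fun (alpha M q) s" using alpha_less_iff[OF q rr] r(2) by simp
    then obtain N where N: "\<And>c' d'. agree N (alpha M q) c' \<Longrightarrow> agree N s d' \<Longrightarrow> less_fun c' d'"
      by (rule less_fun_open) blast
    obtain v where v: "v \<in> bi_univoque_bases M" "v < q" "agree N s (alpha M v)"
      using s(3)[of N] by (auto simp: T_def)
    have "less_fun (alpha M q) (alpha M v)" by (rule N[OF _ v(3)]) (simp add: agree_def)
    then show False using alpha_less_iff[OF q bi_univoque_range[OF v(1)]] v(2) by simp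
  qed
  ultimately have "r = q" by simp
  then show "q \<in> bi_univoque_bases M"
    "\<exists>v\<in>bi_univoque_bases M. v < q \<and> agree N (alpha M q) (alpha M v)"
    using r s(3)[of N] by (auto simp: T_def)
qed

lemma right_limit_bi_univoque:
  assumes q: "q \<in> {1<..real M + 1}" and lim: "right_limit (bi_univoque_bases M) q"
  shows "q \<in> bi_univoque_bases M"
    and "\<exists>v\<in>bi_univoque_bases M. q < v \<and> agree N (alpha M q) (alpha M v)"
proof -
  define A where "A = alpha M ` {v \<in> bi_univoque_bases M. q < v}"
  obtain v0 where "v0 \<in> bi_univoque_bases M" "q < v0" 
    using lim[unfolded right_limit_def, rule_format, of "q + 1"] by auto
  then have "reflect M ` A \<noteq> {}" by (auto simp: A_def)
  moreover have "reflect M ` A \<subseteq> digit_seqs M" by auto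
  ultimately obtain s' where s': "s' \<in> digit_seqs M" "\<And>t. t \<in> reflect M ` A \<Longrightarrow> lex_le t s'"
    "\<And>N. \<exists>t\<in>reflect M ` A. agree N s' t"
    by (rule lex_sup_exists) blast
  have A: "t \<in> digit_seqs M" if "t \<in> A" for t
    using that bi_adm_digits bi_univoque_bi_adm by (auto simp: A_def)
  \<comment> \<open>The lexicographic infimum of \<open>A\<close>, obtained by reflecting the
    supremum of the reflected sequences.\<close>
  define s where "s = reflect M s'"
  have lower: "lex_le s t" if "t \<in> A" for t
    using lex_le_reflect[OF s'(2) s'(1), of "reflect M t"] that A[OF that] by (simp add: s_def)
  have approx: "\<exists>t\<in>A. agree N s t" for N
  proof -
    obtain t where t: "t \<in> A" "agree N s' (reflect M t)" using s'(3)[of N] by blast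
    then have "agree N s (reflect M (reflect M t))" by (simp add: s_def agree_def reflect_apply)
    then show ?thesis using t A by auto
  qed
  have "bi_adm M s"
    using approx bi_univoque_bi_adm by (intro bi_adm_closed) (fastforce simp: A_def)
  then obtain r where r: "r \<in> bi_univoque_bases M" "alpha M r = s" by (rule bi_adm_imp_alpha)
  note rr = bi_univoque_range[OF r(1)]
  have "r \<le> v" if "v \<in> bi_univoque_bases M" "q < v" for v
    using lower[of "alpha M v"] that r(2) alpha_le_iff[OF rr bi_univoque_range[OF that(1)]]
    by (auto simp: A_def)
  then have "\<not> q < r" using lim by (fastforce simp: right_limit_def)
  moreover have "\<not> r < q"
  proof
    assume "r < q"
    then have "less_fun s (alpha M q)" using alpha_less_iff[OF rr q] r(2) by simp
    then obtain N where N: "\<And>c' d'. agree N s c' \<Longrightarrow> agree N (alpha M q) d' \<Longrightarrow> less_fun c' d'"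
      by (rule less_fun_open) blast
    obtain v where v: "v \<in> bi_univoque_bases M" "q < v" "agree N s (alpha M v)"
      using approx[of N] by (auto simp: A_def)
    have "less_fun (alpha M v) (alpha M q)" by (rule N[OF v(3)]) (simp add: agree_def)
    then show False using alpha_less_iff[OF bi_univoque_range[OF v(1)] q] v(2) by simp
  qed
  ultimately have "r = q" by simp
  then show "q \<in> bi_univoque_bases M"
    "\<exists>v\<in>bi_univoque_bases M. q < v \<and> agree N (alpha M q) (alpha M v)"
    using r approx[of N] by (auto simp: A_def)
qed

text \<open>The bound \<open>5 / 4\<close> prevents limit points from reaching the excluded endpoint
  1.\<close>

lemma closed_bi_univoque_bases: "closed (bi_univoque_bases M)"
  unfolding closed_limpt
proof safe
  fix q assume lim: "q islimpt bi_univoque_bases M"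
  have "bi_univoque_bases M \<subseteq> {5 / 4..real M + 1}"
    using bi_univoque_ge bi_univoque_range by auto
  then have "q \<in> {5 / 4..real M + 1}"
    using lim islimpt_subset closed_limpt closed_atLeastAtMost by metis
  then have "q \<in> {1<..real M + 1}" by auto
  then show "q \<in> bi_univoque_bases M"
    using islimpt_real_cases[OF lim] left_limit_bi_univoque(1) right_limit_bi_univoque(1) by blast
qed

text \<open>The base depends continuously on its expansion of 1: the comparison with the expansions
  for nearby bases on either side is visible in a prefix.\<close>

lemma alpha_prefix_close:
  assumes q: "q \<in> {1<..real M + 1}" and "0 < e"
  obtains N where "\<And>u. u \<in> {1<..real M + 1} \<Longrightarrow> agree N (alpha M q) (alpha M u) \<Longrightarrow> \<bar>u - q\<bar> < e"
proof -
  \<comment> \<open>The midpoint \<open>(1 + q) / 2\<close> keeps \<open>p\<close> above 1 when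
    \<open>e\<close> is large.\<close>
  define p where "p = max ((1 + q) / 2) (q - e / 2)"
  have p: "p \<in> {1<..real M + 1}" "p < q" "q - e < p"
    using q \<open>0 < e\<close> by (auto simp: p_def max_def field_simps)
  then have "less_fun (alpha M p) (alpha M q)" using alpha_less_iff q by simp
  then obtain N1 where N1: "\<And>c' d'. agree N1 (alpha M p) c' \<Longrightarrow> agree N1 (alpha M q) d' \<Longrightarrow> less_fun c' d'"
    by (rule less_fun_open) blast
  have lower: "p < u" if "u \<in> {1<..real M + 1}" "agree N1 (alpha M q) (alpha M u)" for u
  proof -
    have "less_fun (alpha M p) (alpha M u)" by (rule N1[OF _ that(2)]) (simp add: agree_def)
    then show ?thesis using alpha_less_iff p that(1) by simp
  qed
  show ?thesis
  proof (cases "q = real M + 1")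
    case True
    then show ?thesis using that[of N1] lower p(3) \<open>0 < e\<close> by fastforce
  next
    case False
    define r where "r = min (real M + 1) (q + e / 2)"
    have r: "r \<in> {1<..real M + 1}" "q < r" "r < q + e"
      using q False \<open>0 < e\<close> by (auto simp: r_def min_def)
    then have "less_fun (alpha M q) (alpha M r)" using alpha_less_iff q by simp
    then obtain N2 where N2: "\<And>c' d'. agree N2 (alpha M q) c' \<Longrightarrow> agree N2 (alpha M r) d' \<Longrightarrow> less_fun c' d'"
      by (rule less_fun_open) blast
    have upper: "u < r" if "u \<in> {1<..real M + 1}" "agree N2 (alpha M q) (alpha M u)" for u
    proof -
      have "less_fun (alpha M u) (alpha M r)" by (rule N2[OF that(2)]) (simp add: agree_def)
      then show ?thesis using alpha_less_iff r that(1) by simp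
    qed
    show ?thesis
    proof (rule that[of "max N1 N2"])
      fix u assume u: "u \<in> {1<..real M + 1}" "agree (max N1 N2) (alpha M q) (alpha M u)"
      have "p < u" "u < r" using u lower upper agree_mono by (meson max.cobounded1 max.cobounded2)+
      then show "\<bar>u - q\<bar> < e" using p(3) r(3) by linarith
    qed
  qed
qed

section \<open>Periods and one-sided limits\<close>

lemma univoque_iff:
  "q \<in> univoque_bases M \<longleftrightarrow> q \<in> {1<..real M + 1} \<and> strict_adm M (alpha M q) (alpha M q)"
  using univoque_bases_range[OF M] univoque_bases_iff[OF M, of q] by auto

lemma univoque_subset: "univoque_bases M \<subseteq> bi_univoque_bases M"
proof
  fix q assume "q \<in> univoque_bases M"
  then have q: "q \<in> {1<..real M + 1}" "weak_adm M (alpha M q) (alpha M q)"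
    using univoque_iff strict_adm_imp_weak_adm by auto
  then show "q \<in> bi_univoque_bases M"
    using bi_adm_iff_weak_adm[OF alpha_digits[OF M] alpha_head_pos[OF M], of q]
    by (simp add: bi_univoque_bases_iff[OF M])
qed

lemma univoque_reflect_ne:
  assumes "q \<in> univoque_bases M"
  shows "reflect M (shift n (alpha M q)) \<noteq> alpha M q"
proof
  assume eq: "reflect M (shift n (alpha M q)) = alpha M q"
  have "bi_adm M (alpha M q)" using assms univoque_subset bi_univoque_bi_adm by blast
  then obtain k where k: "0 < alpha M q k" "reflect M (shift (Suc k) (alpha M q)) = alpha M q"
    using reflected_period_after_positive M eq by blast
  then have "less_fun (reflect M (shift (Suc k) (alpha M q))) (alpha M q)"
    using assms unfolding univoque_iff strict_adm_def by blast
  then show False using k(2) by (simp add: less_fun_irrefl)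
qed

text \<open>Strictness only covers tails after a non-maximal digit. A period preceded by
  \<open>M\<close> would make the sequence constantly \<open>M\<close>, which happens only in the
  largest base.\<close>

lemma univoque_shift_ne:
  assumes "q \<in> univoque_bases M" "q \<noteq> real M + 1" "0 < n"
  shows "shift n (alpha M q) \<noteq> alpha M q"
proof
  assume eq: "shift n (alpha M q) = alpha M q"
  have q: "1 < q" "q \<le> real M + 1" "q < real M + 1" using assms univoque_iff by auto
  note d = alpha_digits[OF M q(1,2)]
  obtain k where k: "n = Suc k" using assms(3) gr0_implies_Suc by blast
  show False
  proof (cases "alpha M q k < M")
    case True
    then have "less_fun (shift (Suc k) (alpha M q)) (alpha M q)"
      using assms unfolding univoque_iff strict_adm_def by blast
    then show False using eq k by (simp add: less_fun_irrefl)
  next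
    case False
    then have "shift k (alpha M q) 0 = M" using digit_seqs_le[OF d, of k] by (simp add: shift_apply)
    moreover have "shift (Suc 0) (shift k (alpha M q)) = alpha M q" using eq k by simp
    ultimately have "alpha M q = (\<lambda>_. M)"
      using cons_max_le_imp_const[OF d alpha_shift_le[OF M q(1,2)]] by blast
    then show False using alpha_ne_const[OF M q(1,2,3)] by blast
  qed
qed

text \<open>A base in \<open>bi_univoque_bases\<close> but not in \<open>univoque_bases\<close> has a periodic expansion of 1; an
  admissible sequence above it sharing one period would exceed itself after a shift.\<close>

lemma right_limit_imp_univoque:
  assumes q: "q \<in> {1<..real M + 1}" and lim: "right_limit (bi_univoque_bases M) q"
  shows "q \<in> univoque_bases M"
proof (rule ccontr)
  let ?s = "alpha M q"
  assume "q \<notin> univoque_bases M"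
  then have ns: "\<not> strict_adm M ?s ?s" using q univoque_iff by blast
  have ba: "bi_adm M ?s" using right_limit_bi_univoque(1)[OF assms] by (rule bi_univoque_bi_adm)
  have "\<exists>p>0. shift p ?s = ?s"
  proof -
    obtain n where "\<not> less_fun (shift (Suc n) ?s) ?s \<or> \<not> less_fun (reflect M (shift (Suc n) ?s)) ?s"
      using ns by (auto simp: strict_adm_def)
    then have "shift (Suc n) ?s = ?s \<or> reflect M (shift (Suc n) ?s) = ?s"
      using bi_adm_shift_le[OF ba, of "Suc n"] bi_adm_reflect_le[OF ba, of "Suc n"]
      by (auto simp: lex_le_def)
    then show ?thesis
    proof
      assume eq: "reflect M (shift (Suc n) ?s) = ?s"
      have "shift (Suc n) ?s = reflect M ?s"
        using eq reflect_reflect[OF digit_seqs_shift[OF bi_adm_digits[OF ba]], of "Suc n"] by simp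
      then have "shift (Suc n) (shift (Suc n) ?s) = ?s" using eq by simp
      then show ?thesis by (intro exI[of _ "Suc n + Suc n"]) simp
    qed blast
  qed
  then obtain p where p: "0 < p" "shift p ?s = ?s" by blast
  have per: "?s (p + i) = ?s i" for i using p(2) by (metis shift_apply)
  obtain v where v: "v \<in> bi_univoque_bases M" "q < v" "agree p ?s (alpha M v)"
    using right_limit_bi_univoque(2)[OF assms, of p] by blast
  let ?t = "alpha M v"
  have "less_fun ?s ?t" using alpha_less_iff[OF q bi_univoque_range[OF v(1)]] v(2) by simp
  then obtain k where k: "?s k < ?t k" "\<And>i. i < k \<Longrightarrow> ?s i = ?t i" by (auto elim: less_funE)
  have pk: "p \<le> k" using k(1) v(3) by (metis agree_def not_le less_irrefl)
  have "less_fun ?t (shift p ?t)"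
  proof (rule less_funI2[of _ "k - p"])
    show "?t (k - p) < shift p ?t (k - p)"
      using k(1) k(2)[of "k - p"] per[of "k - p"] pk p(1) by (simp add: shift_apply)
    show "?t i = shift p ?t i" if "i < k - p" for i
      using k(2)[of i] k(2)[of "p + i"] per[of i] that by (simp add: shift_apply)
  qed
  then show False using bi_adm_shift_le[OF bi_univoque_bi_adm[OF v(1)], of p] not_lex_le by blast
qed

text \<open>The first drop of \<open>t\<close> below \<open>s\<close> lies beyond the shared period,
  and reflection turns it into a rise above \<open>s\<close> one period earlier.\<close>

lemma reflected_period_contradiction:
  assumes eq: "reflect M (shift (Suc k) s) = s" and s: "s \<in> digit_seqs M"
    and t: "less_fun t s" "agree (Suc k) s t"
  shows "less_fun s (reflect M (shift (Suc k) t))"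
proof -
  obtain n where n: "t n < s n" "\<And>i. i < n \<Longrightarrow> t i = s i" using t(1) by (auto elim: less_funE)
  have kn: "Suc k \<le> n" using n(1) t(2) by (metis agree_def not_le less_irrefl)
  have eq': "M - s (Suc k + i) = s i" for i using eq by (metis reflect_apply shift_apply)
  show ?thesis
  proof (rule less_funI2[of _ "n - Suc k"])
    show "s (n - Suc k) < reflect M (shift (Suc k) t) (n - Suc k)"
      using n(1) eq'[of "n - Suc k"] kn digit_seqs_le[OF s, of n] by (simp add: shift_apply reflect_apply)
    show "s i = reflect M (shift (Suc k) t) i" if "i < n - Suc k" for i
      using n(2)[of "Suc k + i"] eq'[of i] that by (simp add: shift_apply reflect_apply)
  qed
qed

lemma left_limit_reflect_ne:
  assumes q: "q \<in> {1<..real M + 1}" and lim: "left_limit (bi_univoque_bases M) q"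
  shows "reflect M (shift n (alpha M q)) \<noteq> alpha M q"
proof
  let ?s = "alpha M q"
  assume "reflect M (shift n ?s) = ?s"
  moreover have ba: "bi_adm M ?s" using left_limit_bi_univoque(1)[OF assms] by (rule bi_univoque_bi_adm)
  ultimately obtain k where k: "reflect M (shift (Suc k) ?s) = ?s"
    using reflected_period_after_positive M by blast
  obtain v where v: "v \<in> bi_univoque_bases M" "v < q" "agree (Suc k) ?s (alpha M v)"
    using left_limit_bi_univoque(2)[OF assms, of "Suc k"] by blast
  have "less_fun (alpha M v) ?s" using alpha_less_iff[OF bi_univoque_range[OF v(1)] q] v(2) by simp
  then have "less_fun ?s (reflect M (shift (Suc k) (alpha M v)))"
    using reflected_period_contradiction[OF k bi_adm_digits[OF ba]] v(3) by blast
  then have "less_fun (alpha M v) (reflect M (shift (Suc k) (alpha M v)))"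
    using \<open>less_fun (alpha M v) ?s\<close> less_fun_trans by blast
  then show False using bi_adm_reflect_le[OF bi_univoque_bi_adm[OF v(1)], of "Suc k"] not_lex_le by blast
qed

lemma reflect_ne_imp_left_limit:
  assumes q: "q \<in> bi_univoque_bases M" and ne: "\<And>n. reflect M (shift n (alpha M q)) \<noteq> alpha M q"
  shows "left_limit (bi_univoque_bases M) q"
  unfolding left_limit_def
proof safe
  let ?s = "alpha M q"
  have ba: "bi_adm M ?s" using q by (rule bi_univoque_bi_adm)
  note d = bi_adm_digits[OF ba]
  fix p assume "p < q"
  then obtain N where N: "\<And>u. u \<in> {1<..real M + 1} \<Longrightarrow> agree N ?s (alpha M u) \<Longrightarrow> \<bar>u - q\<bar> < q - p"
    using alpha_prefix_close[OF bi_univoque_range[OF q], of "q - p"] by auto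
  obtain m where m: "max N 2 < m" "good_word M m ?s" using good_prefixes[OF ba ne] by blast
  then have m2: "2 \<le> m" by simp
  let ?z = "zigzag M m ?s"
  obtain v where v: "v \<in> bi_univoque_bases M" "alpha M v = ?z"
    using bi_adm_imp_alpha[OF bi_adm_zigzag[OF m(2) m2]] by blast
  have agz: "?z i = ?s i" if "i < m" for i using that by (rule zigzag_lt[OF m(2) m2])
  then have "agree N ?s (alpha M v)" using v(2) m(1) by (simp add: agree_def)
  then have "\<bar>v - q\<bar> < q - p" using N bi_univoque_range[OF v(1)] by blast
  moreover have "less_fun ?z ?s"
  proof (rule ccontr)
    \<comment> \<open>Cancelling the common block and reflecting gives
      \<open>lex_le ?z (reflect M (shift m ?s))\<close>, whose right side is at most
      \<open>?s\<close>. With the assumption all three coincide, a reflected period of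
      \<open>?s\<close>.\<close>
    assume "\<not> less_fun ?z ?s"
    then have le: "lex_le ?s ?z" by (simp add: not_less_fun)
    then have "lex_le (shift m ?s) (shift m ?z)" using agz by (intro lex_le_shift) auto
    also have "shift m ?z = reflect M ?z" using shift_zigzag_add[OF m(2) m2, of 0] by simp
    finally have "lex_le (reflect M (reflect M ?z)) (reflect M (shift m ?s))"
      by (rule lex_le_reflect) simp
    then have "lex_le ?z (reflect M (shift m ?s))" using zigzag_digits[OF m(2) m2] by simp
    then have "reflect M (shift m ?s) = ?s"
      using le bi_adm_reflect_le[OF ba] lex_le_trans lex_le_antisym by metis
    then show False using ne by blast
  qed
  then have "v < q" using alpha_less_iff[OF bi_univoque_range[OF v(1)] bi_univoque_range[OF q]] v(2) by simp
  ultimately have "p < v" by linarith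
  then show "\<exists>v\<in>bi_univoque_bases M. p < v \<and> v < q" using v(1) \<open>v < q\<close> by blast
qed

text \<open>\<open>zigzag\<close> would not do here, since its reflected period excludes a univoque
  base; \<open>zigzag_succ\<close> shares the prefix and satisfies strict bounds.\<close>

lemma reflect_ne_imp_closure_univoque:
  assumes q: "q \<in> bi_univoque_bases M" and ne: "\<And>n. reflect M (shift n (alpha M q)) \<noteq> alpha M q"
  shows "q \<in> closure (univoque_bases M)"
  unfolding closure_approachable
proof safe
  let ?s = "alpha M q"
  have ba: "bi_adm M ?s" using q by (rule bi_univoque_bi_adm)
  fix e :: real assume "0 < e"
  then obtain N where N: "\<And>u. u \<in> {1<..real M + 1} \<Longrightarrow> agree N ?s (alpha M u) \<Longrightarrow> \<bar>u - q\<bar> < e"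
    using alpha_prefix_close[OF bi_univoque_range[OF q]] by blast
  obtain m where m: "max N 2 < m" "good_word M m ?s" using good_prefixes[OF ba ne] by blast
  then have m2: "2 \<le> m" by simp
  let ?t = "zigzag_succ M m ?s"
  note strict = zigzag_succ_strict[OF m(2) m2]
  have "lex_le (shift n ?t) ?t" for n using strict(1)[of n] by (cases n) (auto simp: lex_le_def)
  then have "bi_adm M ?t"
    using zigzag_succ_digits[OF m(2) m2] strict(2) by (simp add: bi_adm_def less_fun_imp_lex_le)
  then obtain u where u: "u \<in> bi_univoque_bases M" "alpha M u = ?t" using bi_adm_imp_alpha by blast
  have "strict_adm M ?t ?t" using strict by (simp add: strict_adm_def)
  then have "u \<in> univoque_bases M" using univoque_iff bi_univoque_range[OF u(1)] u(2) by simp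
  moreover have "agree N ?s (alpha M u)"
    using agree_zigzag_succ[OF m(2) m2] m(1) u(2) by (simp add: agree_def)
  then have "\<bar>u - q\<bar> < e" using N bi_univoque_range[OF u(1)] by blast
  ultimately show "\<exists>u\<in>univoque_bases M. dist u q < e" by (auto simp: dist_real_def)
qed

text \<open>A point of the closure might be approached from the right only, but then it is univoque,
  and every univoque base is a left limit.\<close>

lemma closure_univoque_iff: "q \<in> closure (univoque_bases M) \<longleftrightarrow> q \<in> {1<..real M + 1} \<and> left_limit (bi_univoque_bases M) q"
proof safe
  have univ: "left_limit (bi_univoque_bases M) q" if "q \<in> univoque_bases M"
    using that univoque_subset univoque_reflect_ne by (intro reflect_ne_imp_left_limit) auto
  assume cl: "q \<in> closure (univoque_bases M)"
  then have V: "q \<in> bi_univoque_bases M"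
    using closure_minimal[OF univoque_subset closed_bi_univoque_bases] by blast
  then show r: "q \<in> {1<..real M + 1}" by (rule bi_univoque_range)
  show "left_limit (bi_univoque_bases M) q"
  proof (cases "q \<in> univoque_bases M")
    case False
    then have "q islimpt univoque_bases M" using cl by (simp add: closure_def)
    then have "q islimpt bi_univoque_bases M" using univoque_subset by (rule islimpt_subset)
    then show ?thesis using islimpt_real_cases right_limit_imp_univoque[OF r] univ by blast
  qed (rule univ)
next
  assume "q \<in> {1<..real M + 1}" "left_limit (bi_univoque_bases M) q"
  then show "q \<in> closure (univoque_bases M)"
    using left_limit_bi_univoque(1) left_limit_reflect_ne reflect_ne_imp_closure_univoque by blast
qed

text \<open>Below the top, the expansion has no period, so long prefixes with raised last digit are
  good and their \<open>zigzag\<close> gives bases slightly above \<open>q\<close>. The largest base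
  has nothing above it and needs its own disjunct.\<close>

lemma univoque_iff_right_limit:
  "q \<in> univoque_bases M \<longleftrightarrow> q \<in> {1<..real M + 1} \<and> (q = real M + 1 \<or> right_limit (bi_univoque_bases M) q)"
proof safe
  assume U: "q \<in> univoque_bases M"
  then show "q \<in> {1<..real M + 1}" using univoque_iff by blast
  assume nr: "\<not> right_limit (bi_univoque_bases M) q"
  show "q = real M + 1"
  proof (rule ccontr)
    assume ne: "q \<noteq> real M + 1"
    let ?s = "alpha M q"
    have q: "q \<in> bi_univoque_bases M" using U univoque_subset by blast
    have ba: "bi_adm M ?s" using q by (rule bi_univoque_bi_adm)
    have "right_limit (bi_univoque_bases M) q"
      unfolding right_limit_def
    proof safe
      fix r assume "q < r"
      then obtain N where N: "\<And>u. u \<in> {1<..real M + 1} \<Longrightarrow> agree N ?s (alpha M u) \<Longrightarrow> \<bar>u - q\<bar> < r - q"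
        using alpha_prefix_close[OF bi_univoque_range[OF q], of "r - q"] by auto
      obtain m where m: "max N 2 < m" and good: "good_word M (Suc m) (?s(m := Suc (?s m)))"
        using good_increased_prefixes[OF ba univoque_shift_ne[OF U ne]] by blast
      then have m2: "2 \<le> Suc m" by simp
      let ?z = "zigzag M (Suc m) (?s(m := Suc (?s m)))"
      obtain v where v: "v \<in> bi_univoque_bases M" "alpha M v = ?z"
        using bi_adm_imp_alpha[OF bi_adm_zigzag[OF good m2]] by blast
      have z: "?z i = (?s(m := Suc (?s m))) i" if "i < Suc m" for i
        using that by (rule zigzag_lt[OF good m2])
      then have "agree N ?s (alpha M v)" using v(2) m by (simp add: agree_def)
      then have "\<bar>v - q\<bar> < r - q" using N bi_univoque_range[OF v(1)] by blast
      moreover have "less_fun ?s ?z" by (rule less_funI2[of _ m]) (use z in auto)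
      then have "q < v" using alpha_less_iff[OF bi_univoque_range[OF q] bi_univoque_range[OF v(1)]] v(2) by simp
      ultimately have "v < r" by linarith
      then show "\<exists>v\<in>bi_univoque_bases M. q < v \<and> v < r" using v(1) \<open>q < v\<close> by blast
    qed
    then show False using nr by blast
  qed
next
  assume "real M + 1 \<in> {1<..real M + 1}"
  have "less_fun (reflect M (shift (Suc n) (\<lambda>_. M))) (\<lambda>_. M)" for n
    using M by (intro less_funI2[of _ 0]) (auto simp: reflect_apply shift_apply)
  then show "real M + 1 \<in> univoque_bases M"
    using M by (simp add: univoque_iff alpha_max strict_adm_def)
qed (rule right_limit_imp_univoque)

section \<open>Comparing the sets of sequences for two bases\<close>

text \<open>Collecting the tails bounded by either kind of admissibility turns both into an upper
  bound on a single set, of which a supremum can be formed.\<close>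

definition flipped_tails :: "(nat \<Rightarrow> nat) \<Rightarrow> (nat \<Rightarrow> nat) set" where
  "flipped_tails c = {shift (Suc n) c | n. c n < M} \<union> {reflect M (shift (Suc n) c) | n. 0 < c n}"

lemma weak_adm_iff_flipped_tails: "weak_adm M a c \<longleftrightarrow> (\<forall>t\<in>flipped_tails c. lex_le t a)"
  and strict_adm_iff_flipped_tails: "strict_adm M a c \<longleftrightarrow> (\<forall>t\<in>flipped_tails c. less_fun t a)"
  unfolding weak_adm_def strict_adm_def flipped_tails_def by blast+

lemma flipped_tails_shift: "flipped_tails (shift n c) \<subseteq> flipped_tails c"
  by (auto simp: flipped_tails_def shift_apply)

text \<open>Reflection swaps the two kinds of tails together with their digit conditions. This makes
  the supremum of the set bound its own flipped tails.\<close>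

lemma flipped_tails_trans:
  assumes c: "c \<in> digit_seqs M" and t: "t \<in> flipped_tails c" and u: "u \<in> flipped_tails t"
  shows "u \<in> flipped_tails c"
proof -
  from t consider n where "t = shift (Suc n) c" | n where "t = reflect M (shift (Suc n) c)"
    by (auto simp: flipped_tails_def)
  then show ?thesis
  proof cases
    case (2 n)
    let ?x = "shift (Suc n) c"
    have x: "?x \<in> digit_seqs M" using c by simp
    have "flipped_tails (reflect M ?x) \<subseteq> flipped_tails ?x"
    proof
      fix u assume "u \<in> flipped_tails (reflect M ?x)"
      then consider k where "u = shift (Suc k) (reflect M ?x)" "reflect M ?x k < M"
        | k where "u = reflect M (shift (Suc k) (reflect M ?x))" "0 < reflect M ?x k"
        unfolding flipped_tails_def by blast
      then show "u \<in> flipped_tails ?x"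
      proof cases
        case (1 k)
        then have "0 < ?x k" by (simp add: reflect_apply) 
        then show ?thesis using 1(1) by (auto simp: flipped_tails_def)
      next
        case (2 k)
        then have "?x k < M" by (simp add: reflect_apply)
        moreover have "u = shift (Suc k) ?x" using 2(1) c by simp
        ultimately show ?thesis by (auto simp: flipped_tails_def)
      qed
    qed
    then show ?thesis using u 2 flipped_tails_shift by blast
  next
    case (1 n)
    then show ?thesis using u flipped_tails_shift by blast
  qed
qed

text \<open>The supremum of the flipped tails of \<open>c\<close> bounds its own flipped tails, so it is the
  quasi-greedy expansion of 1 in some base of \<open>bi_univoque_bases\<close>.\<close>

lemma flipped_tails_sup:
  assumes c: "c \<in> digit_seqs M" and q: "q \<in> {1<..real M + 1}" and r: "r \<in> {1<..real M + 1}"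
    and wa: "weak_adm M (alpha M r) c" and t0: "t0 \<in> flipped_tails c" "lex_le (alpha M q) t0"
  obtains v where "v \<in> bi_univoque_bases M" "q \<le> v" "v \<le> r" "lex_le t0 (alpha M v)"
    "\<And>N. \<exists>t\<in>flipped_tails c. agree N (alpha M v) t"
proof -
  let ?T = "flipped_tails c"
  have "?T \<noteq> {}" using t0 by blast
  moreover have T: "?T \<subseteq> digit_seqs M" using c by (auto simp: flipped_tails_def)
  ultimately obtain s where s: "s \<in> digit_seqs M" "\<And>t. t \<in> ?T \<Longrightarrow> lex_le t s" "\<And>N. \<exists>t\<in>?T. agree N s t"
    by (rule lex_sup_exists) blast
  have "lex_le u s" if u: "u \<in> flipped_tails s" for u
  proof (rule ccontr)
    assume "\<not> lex_le u s"
    \<comment> \<open>The excess of \<open>u\<close> over \<open>s\<close> is visible in finite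
      prefixes. A member of \<open>?T\<close> sharing a long enough prefix with \<open>s\<close>
      then has a flipped tail, again in \<open>?T\<close>, above the supremum.\<close>
    then have "less_fun s u" by simp
    then obtain N where N: "\<And>c' d'. agree N s c' \<Longrightarrow> agree N u d' \<Longrightarrow> less_fun c' d'"
      by (rule less_fun_open) blast
    from u consider n where "u = shift (Suc n) s" "s n < M" | n where "u = reflect M (shift (Suc n) s)" "0 < s n"
      unfolding flipped_tails_def by blast
    then show False
    proof cases
      case (1 n)
      obtain t where t: "t \<in> ?T" "agree (Suc n + N) s t" using s(3) by blast
      have "t n < M" using t(2) 1(2) by (simp add: agree_def)
      then have "shift (Suc n) t \<in> ?T" using flipped_tails_trans[OF c t(1)] by (auto simp: flipped_tails_def)
      moreover have "less_fun s (shift (Suc n) t)"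
        by (rule N) (use t(2) 1(1) in \<open>auto simp: agree_def shift_apply\<close>)
      ultimately show ?thesis using s(2) not_lex_le by blast
    next
      case (2 n)
      obtain t where t: "t \<in> ?T" "agree (Suc n + N) s t" using s(3) by blast
      have "0 < t n" using t(2) 2(2) by (simp add: agree_def)
      then have "reflect M (shift (Suc n) t) \<in> ?T"
        using flipped_tails_trans[OF c t(1)] by (auto simp: flipped_tails_def)
      moreover have "less_fun s (reflect M (shift (Suc n) t))"
        by (rule N) (use t(2) 2(1) in \<open>auto simp: agree_def shift_apply reflect_apply\<close>)
      ultimately show ?thesis using s(2) not_lex_le by blast
    qed
  qed
  then have "weak_adm M s s" by (simp add: weak_adm_iff_flipped_tails)
  have "lex_le (alpha M q) s" using t0 s(2) lex_le_trans by blast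
  moreover have "0 < alpha M q 0" using alpha_head_pos[OF M, of q] q by simp
  ultimately have "0 < s 0" using lex_le_head by fastforce
  then have "bi_adm M s" using bi_adm_iff_weak_adm s(1) \<open>weak_adm M s s\<close> by blast
  then obtain v where v: "v \<in> bi_univoque_bases M" "alpha M v = s" by (rule bi_adm_imp_alpha)
  note vr = bi_univoque_range[OF v(1)]
  have "lex_le s (alpha M r)"
  proof (rule ccontr)
    assume "\<not> lex_le s (alpha M r)"
    then have "less_fun (alpha M r) s" by simp
    then obtain N where N: "\<And>c' d'. agree N (alpha M r) c' \<Longrightarrow> agree N s d' \<Longrightarrow> less_fun c' d'"
      by (rule less_fun_open) blast
    obtain t where t: "t \<in> ?T" "agree N s t" using s(3) by blast
    have "less_fun (alpha M r) t" by (rule N[OF _ t(2)]) (simp add: agree_def)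
    moreover have "lex_le t (alpha M r)" using wa t(1) by (simp add: weak_adm_iff_flipped_tails)
    ultimately show False using not_lex_le by blast
  qed
  then have "v \<le> r" using alpha_le_iff[OF vr r] v(2) by simp
  moreover have "q \<le> v" using alpha_le_iff[OF q vr] v(2) \<open>lex_le (alpha M q) s\<close> by simp
  ultimately show ?thesis using that v s t0(1) by blast
qed

text \<open>Admissibility never bounds the sequence itself. The leading 0 turns all of
  \<open>c\<close> into a bounded tail, so that membership of \<open>zero_cons (alpha M v)\<close>
  detects the base \<open>v\<close>.\<close>

definition zero_cons :: "(nat \<Rightarrow> nat) \<Rightarrow> nat \<Rightarrow> nat" where
  "zero_cons c = case_nat 0 c"

lemma zero_cons_simps: "zero_cons c 0 = 0" "zero_cons c (Suc n) = c n"
  by (simp_all add: zero_cons_def)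

lemma shift_zero_cons: "shift (Suc n) (zero_cons c) = shift n c"
  by (simp add: fun_eq_iff shift_apply zero_cons_simps)

lemma zero_cons_digits: "c \<in> digit_seqs M \<Longrightarrow> zero_cons c \<in> digit_seqs M"
  by (auto simp: digit_seqs_def zero_cons_def split: nat.split)

lemma univoque_seqs_mem:
  assumes "q \<in> {1<..real M + 1}"
  shows "c \<in> univoque_seqs M q \<longleftrightarrow> c \<in> digit_seqs M \<and> strict_adm M (alpha M q) c"
  using univoque_seqs_eq[OF M, of q] assms by simp

text \<open>The strict bound on \<open>zero_cons (alpha M v)\<close> fails in base \<open>v\<close>
  itself, so a base at \<open>q\<close> separates the families and one at \<open>r\<close> does
  not.\<close>

lemma univoque_seqs_eq_iff:
  assumes q: "q \<in> {1<..real M + 1}" and r: "r \<in> {1<..real M + 1}" and less: "q < r"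
  shows "univoque_seqs M q = univoque_seqs M r \<longleftrightarrow> bi_univoque_bases M \<inter> {q..<r} = {}"
proof
  assume eq: "univoque_seqs M q = univoque_seqs M r"
  have False if v: "v \<in> bi_univoque_bases M" "q \<le> v" "v < r" for v
  proof -
    note vr = bi_univoque_range[OF v(1)]
    note ba = bi_univoque_bi_adm[OF v(1)]
    have "less_fun (alpha M v) (alpha M r)" using alpha_less_iff[OF vr r] v(3) by simp
    then have "strict_adm M (alpha M r) (zero_cons (alpha M v))"
      using bi_adm_shift_le[OF ba] bi_adm_reflect_le[OF ba]
      by (auto simp: strict_adm_def shift_zero_cons intro: lex_le_less_trans)
    then have "zero_cons (alpha M v) \<in> univoque_seqs M q"
      unfolding eq univoque_seqs_mem[OF r] using zero_cons_digits[OF bi_adm_digits[OF ba]] by blast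
    then have "less_fun (shift (Suc 0) (zero_cons (alpha M v))) (alpha M q)"
      using M by (simp add: univoque_seqs_mem[OF q] strict_adm_def zero_cons_simps(1))
    then show False using alpha_less_iff[OF vr q] v(2) by (simp add: shift_zero_cons)
  qed
  then show "bi_univoque_bases M \<inter> {q..<r} = {}" by auto
next
  assume free: "bi_univoque_bases M \<inter> {q..<r} = {}"
  have "lex_le (alpha M q) (alpha M r)" using alpha_le_iff[OF q r] less by simp
  then have "univoque_seqs M q \<subseteq> univoque_seqs M r"
    using univoque_seqs_mem q r strict_adm_mono by blast
  moreover have "c \<in> univoque_seqs M q" if "c \<in> univoque_seqs M r" for c
  proof (rule ccontr)
    assume "c \<notin> univoque_seqs M q"
    have c: "c \<in> digit_seqs M" "strict_adm M (alpha M r) c" using that univoque_seqs_mem[OF r] by auto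
    obtain t0 where t0: "t0 \<in> flipped_tails c" "lex_le (alpha M q) t0"
      using \<open>c \<notin> univoque_seqs M q\<close> c(1)
      by (auto simp: univoque_seqs_mem[OF q] strict_adm_iff_flipped_tails not_less_fun)
    obtain v where v: "v \<in> bi_univoque_bases M" "q \<le> v" "v \<le> r"
      and approx: "\<And>N. \<exists>t\<in>flipped_tails c. agree N (alpha M v) t"
      using flipped_tails_sup[OF c(1) q r strict_adm_imp_weak_adm[OF c(2)] t0] by blast
    \<comment> \<open>All flipped tails lie strictly below the expansion for \<open>r\<close>, yet
      their supremum may equal it; this case remains.\<close>
    have "v = r" using v free by force
    let ?s = "alpha M r"
    have rV: "r \<in> bi_univoque_bases M" using v \<open>v = r\<close> by simp
    note ba = bi_univoque_bi_adm[OF rV]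
    \<comment> \<open>Isolation of \<open>r\<close> from the left gives its expansion a reflected
      period. A flipped tail sharing this period then has a reflected tail that is too
      large.\<close>
    have "\<not> left_limit (bi_univoque_bases M) r"
      using free less by (force simp: left_limit_def)
    then obtain n where "reflect M (shift n ?s) = ?s" using reflect_ne_imp_left_limit[OF rV] by blast
    then obtain k where k: "0 < ?s k" "reflect M (shift (Suc k) ?s) = ?s"
      using reflected_period_after_positive[OF ba M] by blast
    obtain t where t: "t \<in> flipped_tails c" "agree (Suc k) ?s t" using approx \<open>v = r\<close> by blast
    have "less_fun t ?s" using c(2) t(1) by (simp add: strict_adm_iff_flipped_tails)
    then have "less_fun ?s (reflect M (shift (Suc k) t))"
      using reflected_period_contradiction[OF k(2) bi_adm_digits[OF ba]] t(2) by blast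
    moreover have "0 < t k" using t(2) k(1) by (simp add: agree_def)
    then have "reflect M (shift (Suc k) t) \<in> flipped_tails c"
      using flipped_tails_trans[OF c(1) t(1)] by (auto simp: flipped_tails_def)
    ultimately show False
      using c(2) less_fun_asym by (auto simp: strict_adm_iff_flipped_tails)
  qed
  ultimately show "univoque_seqs M q = univoque_seqs M r" by blast
qed

lemma bi_univoque_seqs_mem:
  assumes "q \<in> {1<..<real M + 1}"
  shows "c \<in> bi_univoque_seqs M q \<longleftrightarrow> c \<in> digit_seqs M \<and> weak_adm M (alpha M q) c"
  using bi_univoque_seqs_eq[OF M, of q] assms by simp

text \<open>Under weak bounds \<open>zero_cons (alpha M v)\<close> is already present in base
  \<open>v\<close>, so the right endpoint counts. Hence a free interval avoids the largest base, and
  the separate description of that base matters only in the forward direction.\<close>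

lemma bi_univoque_seqs_eq_iff:
  assumes q: "q \<in> {1<..real M + 1}" and r: "r \<in> {1<..real M + 1}" and less: "q < r"
  shows "bi_univoque_seqs M q = bi_univoque_seqs M r \<longleftrightarrow> bi_univoque_bases M \<inter> {q<..r} = {}"
proof
  have q': "q \<in> {1<..<real M + 1}" using q r less by auto
  {
    assume eq: "bi_univoque_seqs M q = bi_univoque_seqs M r"
    have False if v: "v \<in> bi_univoque_bases M" "q < v" "v \<le> r" for v
    proof -
      note vr = bi_univoque_range[OF v(1)]
      note ba = bi_univoque_bi_adm[OF v(1)]
      let ?c = "zero_cons (alpha M v)"
      have d: "?c \<in> digit_seqs M" using zero_cons_digits[OF bi_adm_digits[OF ba]] .
      have "?c \<in> bi_univoque_seqs M r"
      proof (cases "r = real M + 1")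
        case True
        have "infinite_seq ?c"
        proof
          assume "finite_seq ?c"
          then obtain n where "?c n \<noteq> 0" "\<forall>i>n. ?c i = 0" by (auto simp: finite_seq_def)
          then have "finite_seq (alpha M v)"
            unfolding finite_seq_def by (cases n) (auto simp: zero_cons_simps, metis Suc_mono zero_cons_simps(2))
          then show False using bi_adm_infinite[OF ba] by blast
        qed
        then show ?thesis using d True bi_univoque_seqs_max[OF M] by simp
      next
        case False
        have "lex_le (alpha M v) (alpha M r)" using alpha_le_iff[OF vr r] v(3) by simp
        then have "weak_adm M (alpha M r) ?c"
          using bi_adm_shift_le[OF ba] bi_adm_reflect_le[OF ba]
          by (auto simp: weak_adm_def shift_zero_cons intro: lex_le_trans)
        then show ?thesis using d bi_univoque_seqs_mem[of r] r False by auto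
      qed
      then have "?c \<in> bi_univoque_seqs M q" using eq by simp
      then have "lex_le (shift (Suc 0) ?c) (alpha M q)"
        using M by (simp add: bi_univoque_seqs_mem[OF q'] weak_adm_def zero_cons_simps(1))
      then show False using alpha_le_iff[OF vr q] v(2) by (simp add: shift_zero_cons)
    qed
    then show "bi_univoque_bases M \<inter> {q<..r} = {}" by auto
  }
  assume free: "bi_univoque_bases M \<inter> {q<..r} = {}"
  have "r \<noteq> real M + 1" using free less max_in_bi_univoque[OF M] by auto
  then have r': "r \<in> {1<..<real M + 1}" using r by auto
  have "lex_le (alpha M q) (alpha M r)" using alpha_le_iff[OF q r] less by simp
  then have "bi_univoque_seqs M q \<subseteq> bi_univoque_seqs M r"
    using bi_univoque_seqs_mem q' r' weak_adm_mono by blast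
  moreover have "c \<in> bi_univoque_seqs M q" if "c \<in> bi_univoque_seqs M r" for c
  proof (rule ccontr)
    assume "c \<notin> bi_univoque_seqs M q"
    have c: "c \<in> digit_seqs M" "weak_adm M (alpha M r) c" using that bi_univoque_seqs_mem[OF r'] by auto
    obtain t0 where t0: "t0 \<in> flipped_tails c" "less_fun (alpha M q) t0"
      using \<open>c \<notin> bi_univoque_seqs M q\<close> c(1)
      by (auto simp: bi_univoque_seqs_mem[OF q'] weak_adm_iff_flipped_tails)
    obtain v where v: "v \<in> bi_univoque_bases M" "v \<le> r" "lex_le t0 (alpha M v)"
      using flipped_tails_sup[OF c(1) q r c(2) t0(1) less_fun_imp_lex_le[OF t0(2)]] by blast
    have "less_fun (alpha M q) (alpha M v)" using t0(2) v(3) by (rule less_lex_le_trans)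
    then have "q < v" using alpha_less_iff[OF q bi_univoque_range[OF v(1)]] by simp
    then show False using v free by force
  qed
  ultimately show "bi_univoque_seqs M q = bi_univoque_seqs M r" by blast
qed

end

section \<open>Maximal stability intervals\<close>

text \<open>By \<open>conv\<close> the classes of bases with equal families are intervals, and every
  nonempty stability interval lies inside one of them.\<close>

lemma maximal_stability_intervals_eq:
  assumes M: "0 < M"
    and conv: "\<And>q r p. q \<in> {1<..real M + 1} \<Longrightarrow> r \<in> {1<..real M + 1} \<Longrightarrow>
      q \<le> p \<Longrightarrow> p \<le> r \<Longrightarrow> S q = S r \<Longrightarrow> S p = S r"
  shows "{I. maximal_stability_interval M S I} =
    (\<lambda>q. {r \<in> {1<..real M + 1}. S r = S q}) ` {1<..real M + 1}"
proof -
  define cl where "cl q = {r \<in> {1<..real M + 1}. S r = S q}" for q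
  have stab: "stability_interval M S (cl q)" for q
    unfolding stability_interval_def
  proof (intro conjI)
    show "is_interval (cl q)"
      unfolding is_interval_1
    proof safe
      fix a b x assume ab: "a \<in> cl q" "b \<in> cl q" "a \<le> x" "x \<le> b"
      then have "S x = S b" using conv[of a b x] by (simp add: cl_def)
      then show "x \<in> cl q" using ab by (auto simp: cl_def)
    qed
  qed (auto simp: cl_def)
  have sub: "I \<subseteq> cl q" if "stability_interval M S I" "q \<in> I" for I q
    using that unfolding stability_interval_def cl_def by blast
  have "maximal_stability_interval M S I \<longleftrightarrow> I \<in> cl ` {1<..real M + 1}" for I
  proof
    assume max: "maximal_stability_interval M S I"
    \<comment> \<open>The empty set is a stability interval too; a nonempty class shows that it is
      not maximal.\<close>
    have b: "real M + 1 \<in> cl (real M + 1)" using M by (simp add: cl_def)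
    have "I \<noteq> {}"
      using max stab[of "real M + 1"] b unfolding maximal_stability_interval_def by blast
    then obtain q where q: "q \<in> I" by blast
    have I: "stability_interval M S I" "\<And>K. stability_interval M S K \<Longrightarrow> \<not> I \<subset> K"
      using max unfolding maximal_stability_interval_def by blast+
    have "I = cl q" using sub[OF I(1) q] I(2)[OF stab[of q]] by blast
    moreover have "q \<in> {1<..real M + 1}" using I(1) q unfolding stability_interval_def by blast
    ultimately
    show "I \<in> cl ` {1<..real M + 1}" by blast
  next
    assume "I \<in> cl ` {1<..real M + 1}"
    then obtain q where q: "q \<in> {1<..real M + 1}" "I = cl q" by blast
    then have "q \<in> I" by (simp add: cl_def)
    then have "\<not> (\<exists>K. I \<subset> K \<and> stability_interval M S K)" using sub q(2) by blast
    then show "maximal_stability_interval M S I"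
      using stab q(2) by (simp add: maximal_stability_interval_def)
  qed
  then show ?thesis unfolding cl_def by blast
qed

section \<open>Gaps of a closed set and classes of bases\<close>

locale closed_in_interval =
  fixes V :: "real set" and b :: real
  assumes closed: "closed V" and subset: "V \<subseteq> {1<..b}" and top: "b \<in> V"
begin

text \<open>An endpoint outside \<open>V\<close> could be adjoined without losing connectedness, so
  maximality puts it into \<open>V\<close>; the endpoint 1 is exempt because the ambient interval
  omits it.\<close>

lemma component_iff:
  "{q1<..<q2} \<in> components ({1<..b} - V) \<longleftrightarrow>
    q1 < q2 \<and> (q1 = 1 \<or> q1 \<in> V) \<and> q2 \<in> V \<and> V \<inter> {q1<..<q2} = {}"
proof
  assume comp: "{q1<..<q2} \<in> components ({1<..b} - V)"
  then have ne': "{q1<..<q2} \<noteq> {}" and sub: "{q1<..<q2} \<subseteq> {1<..b} - V"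
    and max: "\<And>D. D \<noteq> {} \<Longrightarrow> {q1<..<q2} \<subseteq> D \<Longrightarrow> D \<subseteq> {1<..b} - V \<Longrightarrow> connected D \<Longrightarrow> D = {q1<..<q2}"
    unfolding in_components_maximal by blast+
  have ne: "q1 < q2" using ne' by simp
  have bounds: "1 \<le> q1" "q2 \<le> b"
  proof -
    show "1 \<le> q1"
    proof (rule ccontr)
      assume "\<not> 1 \<le> q1"
      then obtain m where "q1 < m" "m < min 1 q2" using ne dense[of q1 "min 1 q2"] by auto
      then show False using sub by auto
    qed
    show "q2 \<le> b"
    proof (rule ccontr)
      assume "\<not> q2 \<le> b"
      then obtain m where "max q1 b < m" "m < q2" using ne dense[of "max q1 b" q2] by auto
      then show False using sub by auto
    qed
  qed
  have "q1 = 1 \<or> q1 \<in> V"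
  proof (rule ccontr)
    assume "\<not> ?thesis"
    then have "q1 \<in> {1<..b} - V" using ne bounds by auto
    moreover have "{q1..<q2} = insert q1 {q1<..<q2}" using ne by auto
    ultimately have "{q1..<q2} \<subseteq> {1<..b} - V" using sub by simp
    then have "{q1..<q2} = {q1<..<q2}" using ne by (intro max) auto
    then show False using ne by auto
  qed
  moreover have "q2 \<in> V"
  proof (rule ccontr)
    assume "q2 \<notin> V"
    then have "q2 \<in> {1<..b} - V" using ne bounds by auto
    moreover have "{q1<..q2} = insert q2 {q1<..<q2}" using ne by auto
    ultimately have "{q1<..q2} \<subseteq> {1<..b} - V" using sub by simp
    then have "{q1<..q2} = {q1<..<q2}" using ne by (intro max) auto
    then show False using ne by auto
  qed
  ultimately show "q1 < q2 \<and> (q1 = 1 \<or> q1 \<in> V) \<and> q2 \<in> V \<and> V \<inter> {q1<..<q2} = {}"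
    using ne sub by blast
next
  assume R: "q1 < q2 \<and> (q1 = 1 \<or> q1 \<in> V) \<and> q2 \<in> V \<and> V \<inter> {q1<..<q2} = {}"
  then have bounds: "1 \<le> q1" "q2 \<le> b" using subset by auto
  show "{q1<..<q2} \<in> components ({1<..b} - V)"
    unfolding in_components_maximal
  proof (intro conjI allI impI)
    show "{q1<..<q2} \<subseteq> {1<..b} - V" using R bounds by auto
    fix D assume D: "D \<noteq> {} \<and> {q1<..<q2} \<subseteq> D \<and> D \<subseteq> {1<..b} - V \<and> connected D"
    obtain m where m: "q1 < m" "m < q2" using R dense by blast
    then have "m \<in> D" using D by auto
    have int: "x \<in> D" if "y \<in> D" "z \<in> D" "y \<le> x" "x \<le> z" for x y z
      using D that connectedD_interval by blast
    have "x < q2" if "x \<in> D" for x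
    proof (rule ccontr)
      assume "\<not> x < q2"
      then have "q2 \<in> D" using int[OF \<open>m \<in> D\<close> that] m by simp
      then show False using D R by blast
    qed
    moreover have "q1 < x" if "x \<in> D" for x
    proof (rule ccontr)
      assume "\<not> q1 < x"
      then have "q1 \<in> D" using int[OF that \<open>m \<in> D\<close>] m by simp
      then show False using D R by auto
    qed
    ultimately show "D = {q1<..<q2}" using D by auto
  qed (use R in auto)
qed

lemma least_above:
  assumes "x \<le> b"
  obtains v where "v \<in> V" "x \<le> v" "V \<inter> {x..<v} = {}"
proof -
  define A where "A = V \<inter> {x..}"
  have A: "A \<noteq> {}" "bdd_below A" "closed A" using assms top closed by (auto simp: A_def)
  have "Inf A \<in> A" using closed_contains_Inf A by blast
  moreover have "V \<inter> {x..<Inf A} = {}"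
    using cInf_lower[OF _ A(2)] by (force simp: A_def)
  ultimately show ?thesis using that by (auto simp: A_def)
qed

lemma greatest_below:
  assumes "1 \<le> x"
  obtains v where "v = 1 \<or> v \<in> V" "v \<le> x" "V \<inter> {v<..x} = {}"
proof -
  define A where "A = insert 1 (V \<inter> {..x})"
  have A: "A \<noteq> {}" "bdd_above A" "closed A"
    using assms closed by (auto simp: A_def closed_insert closed_Int)
  have "Sup A \<in> A" using closed_contains_Sup A by blast
  moreover have "V \<inter> {Sup A<..x} = {}"
    using cSup_upper[OF _ A(2)] by (force simp: A_def)
  moreover have "Sup A = 1 \<or> Sup A \<in> V" "Sup A \<le> x"
    using \<open>Sup A \<in> A\<close> assms unfolding A_def by auto
  ultimately show ?thesis using that[of "Sup A"] by blast
qed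

lemma left_limit_mem:
  assumes "left_limit V q"
  shows "q \<in> V"
proof -
  have "\<exists>v\<in>V. dist v q < e" if "0 < e" for e
  proof -
    have "q - e < q" using that by simp
    then obtain v where "v \<in> V" "q - e < v" "v < q" using assms unfolding left_limit_def by blast
    then show ?thesis by (intro bexI[of _ v]) (auto simp: dist_real_def)
  qed
  then show ?thesis using closed_approachable[OF closed] by blast
qed

lemma right_limit_mem:
  assumes "right_limit V q"
  shows "q \<in> V"
proof -
  have "\<exists>v\<in>V. dist v q < e" if "0 < e" for e
  proof -
    have "q < q + e" using that by simp
    then obtain v where "v \<in> V" "q < v" "v < q + e" using assms unfolding right_limit_def by blast
    then show ?thesis by (intro bexI[of _ v]) (auto simp: dist_real_def)
  qed
  then show ?thesis using closed_approachable[OF closed] by blast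
qed

text \<open>The gap ends at the first point of \<open>V\<close> from \<open>q\<close> on, possibly
  \<open>q\<close> itself; its left end is sought from \<open>p\<close>, short of
  \<open>q\<close>.\<close>

lemma component_below:
  assumes "q \<in> {1<..b}" "\<not> left_limit V q"
  obtains q1 q2 where "{q1<..<q2} \<in> components ({1<..b} - V)" "q \<in> {q1<..q2}"
proof -
  obtain p where p: "p < q" "V \<inter> {p<..<q} = {}" 
    using assms(2) by (auto simp: left_limit_def disjoint_iff)
  obtain q2 where q2: "q2 \<in> V" "q \<le> q2" "V \<inter> {q..<q2} = {}"
    using least_above[of q] assms(1) by auto
  \<comment> \<open>\<open>p\<close> may lie below 1, where \<open>greatest_below\<close> does not
    apply.\<close>
  have "1 \<le> max 1 p" by simp
  then obtain q1 where q1: "q1 = 1 \<or> q1 \<in> V" "q1 \<le> max 1 p" "V \<inter> {q1<..max 1 p} = {}"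
    by (rule greatest_below)
  have "q1 < q" using q1(2) p(1) assms(1) by auto
  moreover have "x \<notin> V" if "q1 < x" "x < q2" for x
    using that q1(3) p(2) q2(3) subset by (cases "x \<le> max 1 p"; cases "x < q") auto
  then have "V \<inter> {q1<..<q2} = {}" by auto
  ultimately have "{q1<..<q2} \<in> components ({1<..b} - V)"
    using q1(1) q2 by (simp add: component_iff)
  then show ?thesis using that \<open>q1 < q\<close> q2(2) by simp
qed

text \<open>Here \<open>q\<close> may be the left end of the gap, so the search for the right end
  starts at \<open>r\<close>, past \<open>q\<close>.\<close>

lemma component_above:
  assumes "q \<in> {1<..b}" "q \<noteq> b" "\<not> right_limit V q"
  obtains q1 q2 where "{q1<..<q2} \<in> components ({1<..b} - V)" "q1 \<le> q" "q < q2"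
proof -
  obtain r where r: "q < r" "V \<inter> {q<..<r} = {}" 
    using assms(3) by (auto simp: right_limit_def disjoint_iff)
  have "r \<le> b" using r top assms(1,2) by force
  then obtain q2 where q2: "q2 \<in> V" "r \<le> q2" "V \<inter> {r..<q2} = {}" by (rule least_above)
  have "1 \<le> q" using assms(1) by simp
  then obtain q1 where q1: "q1 = 1 \<or> q1 \<in> V" "q1 \<le> q" "V \<inter> {q1<..q} = {}"
    by (rule greatest_below)
  have "x \<notin> V" if "q1 < x" "x < q2" for x
    using that q1(3) r(2) q2(3) by (cases "x \<le> q"; cases "x < r") auto
  then have "V \<inter> {q1<..<q2} = {}" by auto
  then have "{q1<..<q2} \<in> components ({1<..b} - V)"
    using q1(1,2) q2 r(1) by (simp add: component_iff)
  then show ?thesis using that q1(2) q2(2) r(1) by simp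
qed

lemma left_closed_free_conv:
  assumes eq: "\<And>q r. q \<in> {1<..b} \<Longrightarrow> r \<in> {1<..b} \<Longrightarrow> q < r \<Longrightarrow> S q = S r \<longleftrightarrow> V \<inter> {q..<r} = {}"
    and "q \<in> {1<..b}" "r \<in> {1<..b}" "q \<le> p" "p \<le> r" "S q = S r"
  shows "S p = S r"
proof (cases "p = r \<or> q = p")
  case False
  then have "V \<inter> {q..<r} = {}" using assms eq[of q r] by auto
  then have "V \<inter> {p..<r} = {}" using assms(4) by auto
  then show ?thesis using eq[of p r] assms False by auto
qed (use assms in auto)

lemma right_closed_free_conv:
  assumes eq: "\<And>q r. q \<in> {1<..b} \<Longrightarrow> r \<in> {1<..b} \<Longrightarrow> q < r \<Longrightarrow> S q = S r \<longleftrightarrow> V \<inter> {q<..r} = {}"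
    and "q \<in> {1<..b}" "r \<in> {1<..b}" "q \<le> p" "p \<le> r" "S q = S r"
  shows "S p = S r"
proof (cases "p = r \<or> q = p")
  case False
  then have "V \<inter> {q<..r} = {}" using assms eq[of q r] by auto
  then have "V \<inter> {p<..r} = {}" using assms(4) by auto
  then show ?thesis using eq[of p r] assms False by auto
qed (use assms in auto)

text \<open>A left limit is separated from smaller bases by nearby points of \<open>V\<close> and
  from larger ones by itself. Every other base lies in a gap or is the right end of one.\<close>

lemma left_closed_classes:
  assumes eq: "\<And>q r. q \<in> {1<..b} \<Longrightarrow> r \<in> {1<..b} \<Longrightarrow> q < r \<Longrightarrow> S q = S r \<longleftrightarrow> V \<inter> {q..<r} = {}"
  shows "(\<lambda>q. {r \<in> {1<..b}. S r = S q}) ` {1<..b} =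
    {{q} | q. q \<in> {1<..b} \<and> left_limit V q} \<union>
    {{q1<..q2} | q1 q2. {q1<..<q2} \<in> components ({1<..b} - V)}" (is "?cl ` _ = ?A \<union> ?B")
proof -
  have eq': "S r = S q \<longleftrightarrow> r = q \<or> r < q \<and> V \<inter> {r..<q} = {} \<or> q < r \<and> V \<inter> {q..<r} = {}"
    if "q \<in> {1<..b}" "r \<in> {1<..b}" for q r
    using eq[of q r] eq[of r q] that by (metis linorder_less_linear)
  have single: "?cl q = {q}" if q: "q \<in> {1<..b}" "left_limit V q" for q
  proof -
    have "V \<inter> {r..<q} \<noteq> {}" if "r < q" for r
      using q(2) that by (force simp: left_limit_def)
    moreover have "V \<inter> {q..<r} \<noteq> {}" if "q < r" for r
      using left_limit_mem[OF q(2)] that by auto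
    ultimately show ?thesis using eq'[OF q(1)] q(1) by blast
  qed
  have comp: "?cl q = {q1<..q2}"
    if c: "{q1<..<q2} \<in> components ({1<..b} - V)" and q: "q \<in> {q1<..q2}" for q q1 q2
  proof -
    have c': "q1 < q2" "q1 = 1 \<or> q1 \<in> V" "q2 \<in> V" "V \<inter> {q1<..<q2} = {}"
      using c by (auto simp: component_iff)
    have q': "q \<in> {1<..b}" using q c' subset by auto
    show ?thesis
    proof (intro equalityI subsetI)
      fix r assume "r \<in> ?cl q"
      then have r: "r \<in> {1<..b}" "S r = S q" by auto
      then have "r = q \<or> r < q \<and> V \<inter> {r..<q} = {} \<or> q < r \<and> V \<inter> {q..<r} = {}"
        using eq'[OF q'] by blast
      then show "r \<in> {q1<..q2}" using q c'(2,3) r(1) by (force simp: disjoint_iff)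
    next
      fix r assume r: "r \<in> {q1<..q2}"
      then have "r \<in> {1<..b}" using c' subset by auto
      moreover have "V \<inter> {r..<q} = {}" "V \<inter> {q..<r} = {}" using c'(4) q r by (auto simp: disjoint_iff)
      ultimately show "r \<in> ?cl q" using eq'[OF q', of r] by auto
    qed
  qed
  show ?thesis
  proof (intro equalityI subsetI)
    fix I assume "I \<in> ?cl ` {1<..b}"
    then obtain q where q: "q \<in> {1<..b}" "I = ?cl q" by blast
    show "I \<in> ?A \<union> ?B"
    proof (cases "left_limit V q")
      case True
      then show ?thesis using single q by blast
    next
      case False
      then obtain q1 q2 where "{q1<..<q2} \<in> components ({1<..b} - V)" "q \<in> {q1<..q2}"
        using component_below q(1) by blast
      then show ?thesis using comp q(2) by blast
    qed
  next
    fix I assume "I \<in> ?A \<union> ?B"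
    then consider q where "I = {q}" "q \<in> {1<..b}" "left_limit V q"
      | q1 q2 where "I = {q1<..q2}" "{q1<..<q2} \<in> components ({1<..b} - V)" by blast
    then show "I \<in> ?cl ` {1<..b}"
    proof cases
      case (1 q)
      then show ?thesis using single[of q] by (intro image_eqI[of _ _ q]) auto
    next
      case (2 q1 q2)
      then have "q1 < q2" "q2 \<in> {1<..b}" using subset by (auto simp: component_iff)
      then show ?thesis using 2 comp[OF 2(2), of q2] by (intro image_eqI[of _ _ q2]) auto
    qed
  qed
qed

text \<open>The mirror image of the preceding classification, with two exceptions: the top
  \<open>b\<close> forms a class without being a right limit, and the first gap has no left end in
  \<open>V\<close> to include.\<close>

lemma right_closed_classes:
  assumes eq: "\<And>q r. q \<in> {1<..b} \<Longrightarrow> r \<in> {1<..b} \<Longrightarrow> q < r \<Longrightarrow> S q = S r \<longleftrightarrow> V \<inter> {q<..r} = {}"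
  shows "(\<lambda>q. {r \<in> {1<..b}. S r = S q}) ` {1<..b} =
    {{q} | q. q \<in> {1<..b} \<and> (q = b \<or> right_limit V q)} \<union> {{1<..<(LEAST q. q \<in> V)}} \<union>
    {{q1..<q2} | q1 q2. {q1<..<q2} \<in> components ({1<..b} - V) \<and> q1 \<noteq> 1}"
    (is "?cl ` _ = ?A \<union> ?B \<union> ?C")
proof -
  have eq': "S r = S q \<longleftrightarrow> r = q \<or> r < q \<and> V \<inter> {r<..q} = {} \<or> q < r \<and> V \<inter> {q<..r} = {}"
    if "q \<in> {1<..b}" "r \<in> {1<..b}" for q r
    using eq[of q r] eq[of r q] that by (metis linorder_less_linear)
  have single: "?cl q = {q}" if q: "q \<in> {1<..b}" "q = b \<or> right_limit V q" for q
  proof -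
    have "q \<in> V" using q(2) top right_limit_mem by blast
    then have "V \<inter> {r<..q} \<noteq> {}" if "r < q" for r using that by auto
    moreover have "V \<inter> {q<..r} \<noteq> {}" if "q < r" "r \<in> {1<..b}" for r
      using q(2) that by (force simp: right_limit_def)
    ultimately show ?thesis using eq'[OF q(1)] q(1) by blast
  qed
  \<comment> \<open>The intersection removes the point 1 if the gap starts there and changes nothing
    otherwise.\<close>
  have comp: "?cl q = {q1..<q2} \<inter> {1<..}"
    if c: "{q1<..<q2} \<in> components ({1<..b} - V)" and q: "q1 \<le> q" "q < q2" "1 < q" for q q1 q2
  proof -
    have c': "q1 < q2" "q1 = 1 \<or> q1 \<in> V" "q2 \<in> V" "V \<inter> {q1<..<q2} = {}"
      using c by (auto simp: component_iff)
    have "q2 \<le> b" using c'(3) subset by auto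
    have q': "q \<in> {1<..b}" using q \<open>q2 \<le> b\<close> by auto
    show ?thesis
    proof (intro equalityI subsetI)
      fix r assume "r \<in> ?cl q"
      then have r: "r \<in> {1<..b}" "S r = S q" by auto
      then have "r = q \<or> r < q \<and> V \<inter> {r<..q} = {} \<or> q < r \<and> V \<inter> {q<..r} = {}"
        using eq'[OF q'] by blast
      then show "r \<in> {q1..<q2} \<inter> {1<..}" using q c'(2,3) r(1) by (force simp: disjoint_iff)
    next
      fix r assume r: "r \<in> {q1..<q2} \<inter> {1<..}"
      then have "r \<in> {1<..b}" using \<open>q2 \<le> b\<close> by auto
      moreover have "V \<inter> {r<..q} = {}" "V \<inter> {q<..r} = {}" using c'(4) q r by (auto simp: disjoint_iff)
      ultimately show "r \<in> ?cl q" using eq'[OF q', of r] by auto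
    qed
  qed
  have first: "{1<..<q2} \<in> components ({1<..b} - V) \<longleftrightarrow> q2 = (LEAST q. q \<in> V)" for q2
  proof -
    have "1 \<le> b" using subset top by auto
    then obtain v where v: "v \<in> V" "V \<inter> {1..<v} = {}" by (rule least_above)
    have "v \<le> w" if "w \<in> V" for w using v(2) that subset by (force simp: disjoint_iff)
    then have least: "(LEAST q. q \<in> V) = v" using v(1) by (intro Least_equality)
    have "1 < v" using v(1) subset by auto
    show ?thesis
      unfolding least
    proof
      assume "{1<..<q2} \<in> components ({1<..b} - V)"
      then have q2: "1 < q2" "q2 \<in> V" "V \<inter> {1<..<q2} = {}" unfolding component_iff by simp_all
      then have "v \<notin> {1<..<q2}" "q2 \<notin> {1..<v}" using v by blast+
      then show "q2 = v" using q2(1) \<open>1 < v\<close> by simp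
    next
      assume "q2 = v"
      moreover have "V \<inter> {1<..<v} = {}" using v(2) by auto
      ultimately show "{1<..<q2} \<in> components ({1<..b} - V)"
        using v(1) \<open>1 < v\<close> by (simp add: component_iff)
    qed
  qed
  show ?thesis
  proof (intro equalityI subsetI)
    fix I assume "I \<in> ?cl ` {1<..b}"
    then obtain q where q: "q \<in> {1<..b}" "I = ?cl q" by blast
    show "I \<in> ?A \<union> ?B \<union> ?C"
    proof (cases "q = b \<or> right_limit V q")
      case True
      then show ?thesis using single q by blast
    next
      case False
      then obtain q1 q2 where c: "{q1<..<q2} \<in> components ({1<..b} - V)" "q1 \<le> q" "q < q2"
        using component_above q(1) by blast
      have "1 < q" using q(1) by simp
      then have I: "I = {q1..<q2} \<inter> {1<..}" using comp[OF c] q(2) by blast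
      show ?thesis
      proof (cases "q1 = 1")
        case True
        then have "I = {1<..<q2}" using I by auto
        moreover have "q2 = (LEAST q. q \<in> V)" using first c(1) True by simp
        ultimately show ?thesis by simp
      next
        case False
        then have "1 < q1" using c(1) subset by (auto simp: component_iff)
        then have "I = {q1..<q2}" using I by auto
        then show ?thesis using c(1) False by blast
      qed
    qed
  next
    fix I assume "I \<in> ?A \<union> ?B \<union> ?C"
    then consider q where "I = {q}" "q \<in> {1<..b}" "q = b \<or> right_limit V q"
      | q2 where "I = {1<..<q2}" "{1<..<q2} \<in> components ({1<..b} - V)"
      | q1 q2 where "I = {q1..<q2}" "{q1<..<q2} \<in> components ({1<..b} - V)" "q1 \<noteq> 1"
      unfolding first by blast
    then show "I \<in> ?cl ` {1<..b}"
    proof cases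
      case (1 q)
      then have "I = ?cl q" using single[of q] by blast
      then show ?thesis using 1(2) by (rule image_eqI)
    next
      case (2 q2)
      then have q2: "1 < q2" "q2 \<le> b" using subset by (auto simp: component_iff)
      \<comment> \<open>The left end 1 is not a base, so an interior point has to represent the
        first gap.\<close>
      then obtain q where q: "1 < q" "q < q2" using dense by blast
      have "?cl q = {1..<q2} \<inter> {1<..}" using comp[OF 2(2), of q] q by simp
      also have "\<dots> = I" using 2(1) by auto
      finally have "I = ?cl q" ..
      moreover have "q \<in> {1<..b}" using q q2 by simp
      ultimately show ?thesis by (rule image_eqI)
    next
      case (3 q1 q2)
      then have q: "q1 < q2" "1 < q1" "q1 \<le> b" using subset by (auto simp: component_iff)
      have "?cl q1 = {q1..<q2} \<inter> {1<..}" using comp[OF 3(2), of q1] q by simp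
      also have "\<dots> = I" using 3(1) q by auto
      finally have "I = ?cl q1" ..
      moreover have "q1 \<in> {1<..b}" using q by simp
      ultimately show ?thesis by (rule image_eqI)
    qed
  qed
qed

end

theorem theorem1p8:
  fixes M :: nat
  assumes "M > 0"
  shows "{I. maximal_stability_interval M (univoque_seqs M) I} =
           {{q} | q. q \<in> closure (univoque_bases M)} \<union>
           {{q1<..q2} | q1 q2. {q1<..<q2} \<in> components ({1<..real M + 1} - bi_univoque_bases M)}
    \<and> {I. maximal_stability_interval M (bi_univoque_seqs M) I} =
           {{q} | q. q \<in> univoque_bases M} \<union>
           {{1<..<min_bi_univoque_base M}} \<union>
           {{q1..<q2} | q1 q2. {q1<..<q2} \<in> components ({1<..real M + 1} - bi_univoque_bases M)
              \<and> q1 \<noteq> 1}"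
proof
  interpret closed_in_interval "bi_univoque_bases M" "real M + 1"
    using closed_bi_univoque_bases[OF assms] bi_univoque_range[OF assms] max_in_bi_univoque[OF assms]
    by unfold_locales auto
  note eq_left = univoque_seqs_eq_iff[OF assms] and eq_right = bi_univoque_seqs_eq_iff[OF assms]
  show "{I. maximal_stability_interval M (univoque_seqs M) I} =
      {{q} | q. q \<in> closure (univoque_bases M)} \<union>
      {{q1<..q2} | q1 q2. {q1<..<q2} \<in> components ({1<..real M + 1} - bi_univoque_bases M)}"
  proof -
    have "{I. maximal_stability_interval M (univoque_seqs M) I} =
        (\<lambda>q. {r \<in> {1<..real M + 1}. univoque_seqs M r = univoque_seqs M q}) ` {1<..real M + 1}"
      by (rule maximal_stability_intervals_eq[OF assms], rule left_closed_free_conv[OF eq_left])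
    also note left_closed_classes[of "univoque_seqs M", OF eq_left]
    finally show ?thesis unfolding closure_univoque_iff[OF assms] .
  qed
  show "{I. maximal_stability_interval M (bi_univoque_seqs M) I} =
      {{q} | q. q \<in> univoque_bases M} \<union> {{1<..<min_bi_univoque_base M}} \<union>
      {{q1..<q2} | q1 q2. {q1<..<q2} \<in> components ({1<..real M + 1} - bi_univoque_bases M) \<and> q1 \<noteq> 1}"
  proof -
    have "{I. maximal_stability_interval M (bi_univoque_seqs M) I} =
        (\<lambda>q. {r \<in> {1<..real M + 1}. bi_univoque_seqs M r = bi_univoque_seqs M q}) ` {1<..real M + 1}"
      by (rule maximal_stability_intervals_eq[OF assms], rule right_closed_free_conv[OF eq_right])
    also note right_closed_classes[of "bi_univoque_seqs M", OF eq_right]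
    finally show ?thesis unfolding univoque_iff_right_limit[OF assms] min_bi_univoque_base_def .
  qed
qed

end
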